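(* For $q\in\mathbb{C}$ with $|q|<1$, the following ten identities hold: $$\sum_{i,j\ge0}\frac{q^{i^2+2ij+j^2}}{(q;q)_{2i}(q;q)_{2j}}=\frac{(-q;q)_\infty^2(-q^8;q^8)_\infty}{(-q^{2},-q^{14};q^{16})_\infty},\qquad \sum_{i,j\ge0}\frac{q^{i^2+2ij+j^2+i+j}}{(q;q)_{2i+1}(q;q)_{2j}}=\frac{1}{(q;q^2)_\infty (q^2;q^4)_\infty^2},$$ $$\sum_{i,j\ge0}\frac{q^{i^2+2ij+j^2+2i+2j}}{(q;q)_{2i+1}(q;q)_{2j+1}}=\frac{(-q;q)_\infty^2(-q^8;q^8)_\infty}{(-q^{6},-q^{10};q^{16})_\infty},\qquad \sum_{i,j\ge0}\frac{q^{i^2+2ij+j^2+j}}{(q;q)_{2i}(q;q)_{2j}}=\frac{(-q^{7},-q^{9},q^{16};q^{16})_\infty}{(q;q)_\infty},$$ $$\sum_{i,j\ge0}\frac{q^{i^2+2ij+j^2+i+2j}}{(q;q)_{2i+1}(q;q)_{2j}}=\frac{(-q^{5},-q^{11},q^{16};q^{16})_\infty}{(q;q)_\infty},\qquad \sum_{i,j\ge0}\frac{q^{i^2+2ij+j^2+i+2j}}{(q;q)_{2i}(q;q)_{2j+1}}=\frac{(-q^{3},-q^{13},q^{16};q^{16})_\infty}{(q;q)_\infty},$$ $$\sum_{i,j\ge0}\frac{q^{i^2+2ij+j^2+2i+3j}}{(q;q)_{2i+1}(q;q)_{2j+1}}=\frac{(-q,-q^{15},q^{16};q^{16})_\infty}{(q;q)_\infty},\qquad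 \sum_{i,j\ge0}\frac{q^{i^2+2ij+j^2}}{(q;q)_{2i+1}(q;q)_{2j}}=\frac{(q^2;q^4)_\infty^2}{(q;q^2)_\infty^3},$$ $$\sum_{i,j\ge0}\frac{q^{i^2+2ij+j^2+2j}}{(q;q)_{2i+1}(q;q)_{2j}}=\frac{(-q;q)_\infty^2(-q^8;q^8)_\infty}{(-q^{2},-q^{14};q^{16})_\infty},\qquad \sum_{i,j\ge0}\frac{q^{i^2+2ij+j^2+2i}}{(q;q)_{2i+1}(q;q)_{2j}}=\frac{(-q;q)_\infty^2(-q^8;q^8)_\infty}{(-q^{6},-q^{10};q^{16})_\infty}.$$
   Context: For $|q|<1$: $(a;q)_\infty=\prod_{k\ge0}(1-aq^k)$; for integers $n\ge0$, $(a;q)_n=\prod_{k=0}^{n-1}(1-aq^k)$; and $(a_1,\dots,a_m;q)_\infty=\prod_{k=1}^m(a_k;q)_\infty$. *)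

theory Defs
  imports "HOL-Analysis.Analysis"
begin

definition qpoch :: "complex \<Rightarrow> complex \<Rightarrow> nat \<Rightarrow> complex" where
  "qpoch a q n = (\<Prod>k<n. 1 - a * q ^ k)"

definition qpoch_inf :: "complex \<Rightarrow> complex \<Rightarrow> complex" where
  "qpoch_inf a q = (\<Prod>k. 1 - a * q ^ k)"

definition qpoch_inf_list :: "complex list \<Rightarrow> complex \<Rightarrow> complex" where
  "qpoch_inf_list as q = (\<Prod>a\<leftarrow>as. qpoch_inf a q)"

text \<open>The infinite product converges for every \<open>a\<close>, including when some factor vanishes,
  so \<open>qpoch_inf\<close> never denotes an unspecified value when the base has norm below 1.\<close>

lemma has_prod_qpoch_inf:
  assumes "norm q < 1"
  shows "(\<lambda>k. 1 - a * q ^ k) has_prod qpoch_inf a q"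
proof -
  have "summable (\<lambda>k. norm (1 - a * q ^ k - 1))"
    using assms by (simp add: norm_mult norm_power summable_mult summable_geometric)
  then have "abs_convergent_prod (\<lambda>k. 1 - a * q ^ k)"
    by (simp only: abs_convergent_prod_conv_summable)
  then have "convergent_prod (\<lambda>k. 1 - a * q ^ k)"
    by (rule abs_convergent_prod_imp_convergent_prod)
  then show ?thesis
    unfolding qpoch_inf_def by (rule convergent_prod_has_prod)
qed

end

theory Submission
  imports Defs
begin

text \<open>
  Put \<open>m = 2i + A\<close>, \<open>n = 2j + B\<close>: the ten series are parity-restricted pieces of series of the
  form \<open>\<Sum> q^((m + n)\<^sup>2/4) x^m y^n / ((q;q)\<^sub>m (q;q)\<^sub>n)\<close>.

  For the four series with right-hand sides \<open>\<Theta> / (q;q)\<^sub>\<infinity>\<close> take \<open>r^4 = q\<close>. Since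
  \<open>\<Sum>\<^bsub>m+n=N\<^esub> r^(2n) / ((q;q)\<^sub>m (q;q)\<^sub>n) = 1 / (r\<^sup>2;r\<^sup>2)\<^sub>N\<close>, Euler's identity gives
  \<open>\<Sum> r^((m+n)\<^sup>2 + 2n) / ((q;q)\<^sub>m (q;q)\<^sub>n) = (-r;r\<^sup>2)\<^sub>\<infinity>\<close>, and by the triple product this is
  \<open>\<Sum>\<^sub>k r^(2k\<^sup>2 + k) / (q;q)\<^sub>\<infinity>\<close>. The residue of the exponent modulo 4 determines the parities of \<open>m\<close>
  and \<open>n\<close> on one side and \<open>k\<close> modulo 4 on the other, so replacing \<open>r\<close> by \<open>\<i>^l r\<close> separates the
  four identities.

  The series over \<open>m\<close> odd, \<open>n\<close> even with weight \<open>q^((i+j)\<^sup>2)\<close> or \<open>q^((i+j)\<^sup>2+i+j)\<close> depend on the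
  unordered pair only; grouping by \<open>\<bar>m - n\<bar>\<close> and summing Durfee rectangles gives theta series over
  \<open>(q;q)\<^sub>\<infinity>\<close>. Let \<open>T\<close> be the first of them, \<open>E\<close> and \<open>D\<close> the even-even and odd-odd series. Writing
  \<open>q^n / (q;q)\<^sub>n = 1 / (q;q)\<^sub>n - 1 / (q;q)\<^sub>n\<^sub>-\<^sub>1\<close> shows that the two remaining odd-even series equal
  \<open>E\<close> and \<open>D\<close>, and that \<open>E + q D = T\<close>, while \<open>\<Sum>\<^bsub>m+n=2M\<^esub> (-1)^n / ((q;q)\<^sub>m (q;q)\<^sub>n) = 1 / (q\<^sup>2;q\<^sup>2)\<^sub>M\<close>
  and Euler's identity give \<open>E - q D = (-q;q\<^sup>2)\<^sub>\<infinity>\<close>.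
\<close>

subsection \<open>q-Pochhammer symbols\<close>

lemma qpoch_0 [simp]: "qpoch a q 0 = 1"
  by (simp add: qpoch_def)

lemma qpoch_Suc: "qpoch a q (Suc n) = qpoch a q n * (1 - a * q ^ n)"
  by (simp add: qpoch_def)

lemma qpoch_q_Suc: "qpoch q q (Suc n) = qpoch q q n * (1 - q ^ Suc n)"
  by (simp add: qpoch_Suc)

lemma qpoch_tendsto:
  assumes "norm q < 1"
  shows "qpoch a q \<longlonglongrightarrow> qpoch_inf a q"
  using has_prod_imp_tendsto'[OF has_prod_qpoch_inf[OF assms]]
  by (simp add: qpoch_def[abs_def])

lemma qpoch_inf_nonzero:
  assumes "norm q < 1" "norm a < 1"
  shows "qpoch_inf a q \<noteq> 0"
proof -
  have "a * q ^ k \<noteq> 1" for k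
  proof -
    have "norm (a * q ^ k) \<le> norm a * 1"
      unfolding norm_mult norm_power using assms
      by (intro mult_left_mono power_le_one) auto
    with assms(2) have "norm (a * q ^ k) < 1" by simp
    then show ?thesis by force
  qed
  then have "0 \<notin> range (\<lambda>k. 1 - a * q ^ k)"
    by auto
  with has_prod_eq_0_iff[OF has_prod_qpoch_inf[OF assms(1), of a]] show ?thesis
    by simp
qed

lemma power_neq_1:
  fixes q :: complex
  assumes "norm q < 1" "n > 0"
  shows "q ^ n \<noteq> 1"
proof
  assume "q ^ n = 1"
  then have "norm q ^ n = 1" by (metis norm_one norm_power)
  moreover have "norm q ^ n < 1" using assms by (simp add: power_less_one_iff)
  ultimately show False by simp
qed

lemma qpoch_q_nonzero:
  assumes "norm q < 1"
  shows "qpoch q q n \<noteq> 0"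
proof -
  have "1 - q * q ^ k \<noteq> 0" for k
    using power_neq_1[OF assms, of "Suc k"] by simp
  then show ?thesis by (simp add: qpoch_def)
qed

text \<open>The inverses converge because the limit \<open>qpoch_inf q q\<close> is nonzero. The
  bound is uniform in n, which is what the domination arguments below rely on.\<close>

lemma inverse_qpoch_q_bounded:
  assumes "norm q < 1"
  obtains C where "C > 0" "\<And>n. norm (inverse (qpoch q q n)) \<le> C"
proof -
  have "(\<lambda>n. inverse (qpoch q q n)) \<longlonglongrightarrow> inverse (qpoch_inf q q)"
    by (rule tendsto_inverse[OF qpoch_tendsto[OF assms] qpoch_inf_nonzero[OF assms assms]])
  then have "Bseq (\<lambda>n. inverse (qpoch q q n))"
    by (intro convergent_imp_Bseq convergentI)
  then show ?thesis
    using that by (auto elim: BseqE)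
qed

text \<open>Even-indexed and odd-indexed factors, separated already in the partial product of length
  2n.\<close>

lemma qpoch_inf_split_base:
  assumes "norm q < 1"
  shows "qpoch_inf a q = qpoch_inf a (q^2) * qpoch_inf (a * q) (q^2)"
proof -
  have q2: "norm (q^2) < 1" using assms by (simp add: norm_power power_less_one_iff)
  have "qpoch a q (2 * n) = qpoch a (q^2) n * qpoch (a * q) (q^2) n" for n
    by (induction n) (simp_all add: qpoch_Suc mult_ac flip: power_mult)
  moreover have "(\<lambda>n. qpoch a q (2 * n)) \<longlonglongrightarrow> qpoch_inf a q"
    using LIMSEQ_subseq_LIMSEQ[OF qpoch_tendsto[OF assms], of "\<lambda>n. 2 * n"]
    by (simp add: strict_mono_def o_def)
  moreover have "(\<lambda>n. qpoch a (q^2) n * qpoch (a * q) (q^2) n)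
      \<longlonglongrightarrow> qpoch_inf a (q^2) * qpoch_inf (a * q) (q^2)"
    by (intro tendsto_mult qpoch_tendsto q2)
  ultimately show ?thesis by (simp add: LIMSEQ_unique)
qed

lemma qpoch_inf_square:
  assumes "norm q < 1"
  shows "qpoch_inf (a^2) (q^2) = qpoch_inf a q * qpoch_inf (-a) q"
proof -
  have q2: "norm (q^2) < 1" using assms by (simp add: norm_power power_less_one_iff)
  have "qpoch (a^2) (q^2) n = qpoch a q n * qpoch (-a) q n" for n
    by (induction n) (simp_all add: qpoch_Suc algebra_simps power2_eq_square power_mult_distrib)
  then have "qpoch (a^2) (q^2) = (\<lambda>n. qpoch a q n * qpoch (-a) q n)" by auto
  moreover have "(\<lambda>n. qpoch a q n * qpoch (-a) q n) \<longlonglongrightarrow> qpoch_inf a q * qpoch_inf (-a) q"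
    by (intro tendsto_mult qpoch_tendsto assms)
  ultimately show ?thesis
    using qpoch_tendsto[OF q2, of "a^2"] by (simp add: LIMSEQ_unique)
qed

lemma qpoch_inf_Suc:
  assumes "norm q < 1"
  shows "qpoch_inf a q = (1 - a) * qpoch_inf (a * q) q"
proof -
  have "qpoch a q (Suc n) = (1 - a) * qpoch (a * q) q n" for n
    unfolding qpoch_def prod.lessThan_Suc_shift by (simp add: mult_ac)
  moreover have "(\<lambda>n. qpoch a q (Suc n)) \<longlonglongrightarrow> qpoch_inf a q"
    by (rule LIMSEQ_Suc[OF qpoch_tendsto[OF assms]])
  moreover have "(\<lambda>n. (1 - a) * qpoch (a * q) q n) \<longlonglongrightarrow> (1 - a) * qpoch_inf (a * q) q"
    by (intro tendsto_intros qpoch_tendsto assms)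
  ultimately show ?thesis by (simp add: LIMSEQ_unique)
qed

section \<open>Summability by geometric domination\<close>

lemma has_sum_nat_geometric_bound:
  fixes f :: "nat \<Rightarrow> complex"
  assumes "0 \<le> \<rho>" "\<rho> < 1" "\<And>n. norm (f n) \<le> C * \<rho> ^ n"
  shows "(f has_sum suminf f) UNIV"
proof -
  have "summable (\<lambda>n. C * \<rho> ^ n)"
    using assms by (intro summable_mult summable_geometric) auto
  then have "summable (\<lambda>n. norm (f n))"
    by (rule summable_comparison_test') (use assms in auto)
  then show "(f has_sum suminf f) UNIV"
    by (intro norm_summable_imp_has_sum summable_sums) (auto intro: summable_norm_cancel)
qed

lemma summable_on_pairs_geometric_bound:
  fixes f :: "nat \<times> nat \<Rightarrow> complex"
  assumes "0 \<le> \<rho>" "\<rho> < 1" "\<And>m n. norm (f (m, n)) \<le> C * \<rho> ^ (m + n)"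
  shows "f summable_on A"
proof -
  have g: "((\<lambda>n. \<rho> ^ n) has_sum (1 / (1 - \<rho>))) UNIV"
    using assms by (intro norm_summable_imp_has_sum geometric_sums) auto
  have "(\<lambda>x. \<rho> ^ fst x * \<rho> ^ snd x) summable_on (UNIV \<times> UNIV)"
  proof (rule summable_on_SigmaI[where g = "\<lambda>m. \<rho> ^ m * (1 / (1 - \<rho>))"])
    show "((\<lambda>n. \<rho> ^ fst (m, n) * \<rho> ^ snd (m, n)) has_sum \<rho> ^ m * (1 / (1 - \<rho>))) UNIV" for m
      using has_sum_cmult_right[OF g, of "\<rho> ^ m"] by simp
    show "(\<lambda>m. \<rho> ^ m * (1 / (1 - \<rho>))) summable_on UNIV"
      using has_sum_cmult_left[OF g] by (rule has_sum_imp_summable)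
  qed (use assms in auto)
  then have "(\<lambda>x. C * (\<rho> ^ fst x * \<rho> ^ snd x)) summable_on UNIV"
    by (intro summable_on_cmult_right) simp
  then have "(\<lambda>x. norm (f x)) summable_on UNIV"
    by (rule Infinite_Sum.abs_summable_on_comparison_test')
       (use assms(3) in \<open>auto simp: power_add mult_ac\<close>)
  then have "f summable_on UNIV"
    by (rule Infinite_Sum.abs_summable_summable)
  then show ?thesis
    by (rule summable_on_subset_banach) simp
qed

subsection \<open>Euler's identity, Durfee rectangles and the Jacobi triple product\<close>

text \<open>Unordered summability of complex families is absolute, so iterating the norms makes the
  product family summable; its value is then the iterated sum.\<close>

lemma has_sum_mult_pairs:
  fixes f g :: "_ \<Rightarrow> complex"
  assumes f: "(f has_sum a) A" and g: "(g has_sum b) B"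
  shows "((\<lambda>(m, n). f m * g n) has_sum (a * b)) (A \<times> B)"
proof (rule has_sum_SigmaI)
  show "((\<lambda>n. case (m, n) of (m, n) \<Rightarrow> f m * g n) has_sum f m * b) B" for m
    using has_sum_cmult_right[OF g] by simp
  show "((\<lambda>m. f m * b) has_sum a * b) A"
    by (rule has_sum_cmult_left[OF f])
  have nf: "(\<lambda>m. norm (f m)) summable_on A" and ng: "(\<lambda>n. norm (g n)) summable_on B"
    using f g by (simp_all add: has_sum_imp_summable flip: summable_on_iff_abs_summable_on_complex)
  then obtain b' where b': "((\<lambda>n. norm (g n)) has_sum b') B"
    by (auto simp: summable_on_def)
  have "(\<lambda>x. norm (f (fst x)) * norm (g (snd x))) summable_on A \<times> B"
  proof (rule summable_on_SigmaI[where g = "\<lambda>m. norm (f m) * b'"])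
    show "((\<lambda>n. norm (f (fst (m, n))) * norm (g (snd (m, n)))) has_sum norm (f m) * b') B" for m
      using has_sum_cmult_right[OF b'] by simp
    show "(\<lambda>m. norm (f m) * b') summable_on A"
      using nf by (rule summable_on_cmult_left)
  qed auto
  then have "(\<lambda>x. norm (case x of (m, n) \<Rightarrow> f m * g n)) summable_on A \<times> B"
    by (simp add: case_prod_unfold norm_mult)
  then show "(\<lambda>(m, n). f m * g n) summable_on A \<times> B"
    by (rule Infinite_Sum.abs_summable_summable)
qed

text \<open>The n-th root of the n-th norm is \<open>norm p ^ n * norm z\<close>, which tends to 0
  for every \<open>z\<close>; powers of 1/2 therefore dominate eventually.\<close>

lemma summable_power_square:
  fixes p z :: complex
  assumes "norm p < 1"
  shows "summable (\<lambda>n. norm (p ^ n\<^sup>2 * z ^ n))"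
proof -
  have "(\<lambda>n. norm p ^ n * norm z) \<longlonglongrightarrow> 0 * norm z"
    using assms by (intro tendsto_mult LIMSEQ_power_zero) auto
  then have "eventually (\<lambda>n. norm p ^ n * norm z < 1 / 2) sequentially"
    by (intro order_tendstoD(2)) auto
  then have "eventually (\<lambda>n. norm (norm (p ^ n\<^sup>2 * z ^ n)) \<le> (1 / 2) ^ n) sequentially"
  proof eventually_elim
    case (elim n)
    have "norm (p ^ n\<^sup>2 * z ^ n) = (norm p ^ n * norm z) ^ n"
      by (simp add: norm_mult norm_power power_mult_distrib power2_eq_square power_mult)
    also have "\<dots> \<le> (1 / 2) ^ n"
      using elim by (intro power_mono) auto
    finally show ?case by simp
  qed
  then show ?thesis
    by (rule summable_comparison_test_ev) (auto intro: summable_geometric)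
qed

text \<open>Euler's identity in base p^2. The coefficient recurrence yields
  \<open>e x = (1 + x * p) * e (p^2 * x)\<close>; iterating it drives the argument to 0, where
  \<open>e\<close> is continuous with value 1.\<close>

lemma euler_qpoch_has_sum:
  fixes p z :: complex
  assumes p: "norm p < 1"
  shows "((\<lambda>n. p ^ n\<^sup>2 * z ^ n / qpoch (p\<^sup>2) (p\<^sup>2) n) has_sum qpoch_inf (- (z * p)) (p\<^sup>2)) UNIV"
proof -
  have p2: "norm (p\<^sup>2) < 1" using p by (simp add: norm_power power_less_one_iff)
  define a where "a n = p ^ n\<^sup>2 / qpoch (p\<^sup>2) (p\<^sup>2) n" for n
  define e where "e x = (\<Sum>n. a n * x ^ n)" for x
  obtain C where C: "C > 0" "\<And>n. norm (inverse (qpoch (p\<^sup>2) (p\<^sup>2) n)) \<le> C"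
    using inverse_qpoch_q_bounded[OF p2] by metis
  have summ_norm: "summable (\<lambda>n. norm (a n * x ^ n))" for x
  proof (rule summable_comparison_test')
    show "summable (\<lambda>n. C * norm (p ^ n\<^sup>2 * x ^ n))"
      by (intro summable_mult summable_power_square p)
    show "norm (norm (a n * x ^ n)) \<le> C * norm (p ^ n\<^sup>2 * x ^ n)" for n
      using mult_right_mono[OF C(2)[of n], of "norm (p ^ n\<^sup>2 * x ^ n)"]
      by (simp add: a_def norm_mult norm_divide norm_inverse field_simps)
  qed
  then have summ: "summable (\<lambda>n. a n * x ^ n)" for x
    by (rule summable_norm_cancel)
  have a_Suc: "a (Suc n) * (1 - (p\<^sup>2) ^ Suc n) = p * (p\<^sup>2) ^ n * a n" for n
  proof -
    have "1 - (p\<^sup>2) ^ Suc n \<noteq> 0" using power_neq_1[OF p2, of "Suc n"] by simp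
    moreover have "p ^ (Suc n)\<^sup>2 = p ^ n\<^sup>2 * (p * (p\<^sup>2) ^ n)"
      by (simp add: power2_eq_square power_add power_mult power_mult_distrib)
    ultimately show ?thesis
      using qpoch_q_nonzero[OF p2, of n]
      by (simp add: a_def qpoch_q_Suc del: power_Suc)
  qed
  have step: "e x = (1 + x * p) * e (p\<^sup>2 * x)" for x
  proof -
    have "e x - e (p\<^sup>2 * x) = (\<Sum>n. a n * x ^ n - a n * (p\<^sup>2 * x) ^ n)"
      unfolding e_def by (intro suminf_diff summ)
    also have "\<dots> = (\<Sum>n. a (Suc n) * x ^ Suc n - a (Suc n) * (p\<^sup>2 * x) ^ Suc n)"
      by (subst suminf_split_head) (auto intro!: summable_diff summ)
    also have "\<dots> = (\<Sum>n. x * p * (a n * (p\<^sup>2 * x) ^ n))"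
    proof (intro suminf_cong)
      fix n
      have "a (Suc n) * x ^ Suc n - a (Suc n) * (p\<^sup>2 * x) ^ Suc n
          = a (Suc n) * (1 - (p\<^sup>2) ^ Suc n) * x ^ Suc n"
        by (simp add: algebra_simps power_mult_distrib)
      then show "a (Suc n) * x ^ Suc n - a (Suc n) * (p\<^sup>2 * x) ^ Suc n
          = x * p * (a n * (p\<^sup>2 * x) ^ n)"
        unfolding a_Suc by (simp add: power_mult_distrib)
    qed
    also have "\<dots> = x * p * e (p\<^sup>2 * x)"
      unfolding e_def by (intro suminf_mult summ)
    finally show ?thesis by (simp add: algebra_simps)
  qed
  have iter: "e z = qpoch (- (z * p)) (p\<^sup>2) n * e ((p\<^sup>2) ^ n * z)" for n
  proof (induction n)
    case (Suc n)
    then show ?case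
      using step[of "(p\<^sup>2) ^ n * z"] by (simp add: qpoch_Suc mult_ac)
  qed simp
  have "isCont e 0"
    unfolding e_def[abs_def] by (rule isCont_powser_converges_everywhere[OF summ])
  moreover have "(\<lambda>n. (p\<^sup>2) ^ n * z) \<longlonglongrightarrow> 0"
    using LIMSEQ_power_zero[OF p2] by (rule tendsto_mult_left_zero)
  ultimately have "(\<lambda>n. e ((p\<^sup>2) ^ n * z)) \<longlonglongrightarrow> e 0"
    by (rule isCont_tendsto_compose)
  moreover have "e 0 = 1"
    using powser_zero[of a] by (simp add: e_def a_def)
  ultimately have "(\<lambda>n. qpoch (- (z * p)) (p\<^sup>2) n * e ((p\<^sup>2) ^ n * z)) \<longlonglongrightarrow> qpoch_inf (- (z * p)) (p\<^sup>2) * 1"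
    by (intro tendsto_mult qpoch_tendsto p2) auto
  then have "e z = qpoch_inf (- (z * p)) (p\<^sup>2)"
    by (simp flip: iter add: LIMSEQ_const_iff)
  moreover have "((\<lambda>n. a n * z ^ n) has_sum e z) UNIV"
    unfolding e_def by (intro norm_summable_imp_has_sum summable_sums summ summ_norm)
  ultimately show ?thesis
    by (simp add: a_def)
qed

text \<open>The sums \<open>F c\<close> satisfy \<open>F c - F (c + 1) = - q^(c + 1) (F (c + 1) - F (c + 2))\<close>; since they
  converge, they cannot depend on \<open>c\<close>, and their limit is the term \<open>s = 0\<close>.\<close>

lemma durfee_rectangle_has_sum:
  fixes q :: complex
  assumes q: "norm q < 1"
  shows "((\<lambda>s. q ^ (s\<^sup>2 + c * s) / (qpoch q q s * qpoch q q (s + c))) has_sum (1 / qpoch_inf q q)) UNIV"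
proof -
  define w where "w = qpoch q q"
  have w_nz: "w n \<noteq> 0" for n
    using qpoch_q_nonzero[OF q] by (simp add: w_def)
  have w_Suc: "w (Suc n) = w n * (1 - q ^ Suc n)" for n
    by (simp add: w_def qpoch_q_Suc)
  obtain C where C: "C > 0" "\<And>n. norm (inverse (w n)) \<le> C"
    using inverse_qpoch_q_bounded[OF q] unfolding w_def by metis
  define t where "t c s = q ^ (s\<^sup>2 + c * s) / (w s * w (s + c))" for c s
  define F where "F c = suminf (t c)" for c
  have t_bound: "norm (t c s) \<le> C\<^sup>2 * norm q ^ (s\<^sup>2 + c * s)" for c s
  proof -
    have "norm (t c s) = norm (inverse (w s)) * norm (inverse (w (s + c))) * norm q ^ (s\<^sup>2 + c * s)"
      by (simp add: t_def norm_divide norm_mult norm_power norm_inverse field_simps)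
    also have "\<dots> \<le> C * C * norm q ^ (s\<^sup>2 + c * s)"
      using C by (intro mult_right_mono mult_mono) auto
    finally show ?thesis by (simp add: power2_eq_square)
  qed
  have t_bound': "norm (t c s) \<le> C\<^sup>2 * norm q ^ s" for c s
  proof -
    have "s \<le> s\<^sup>2 + c * s"
      by (simp add: power2_eq_square trans_le_add1)
    then have "norm q ^ (s\<^sup>2 + c * s) \<le> norm q ^ s"
      using q by (intro power_decreasing) auto
    then have "C\<^sup>2 * norm q ^ (s\<^sup>2 + c * s) \<le> C\<^sup>2 * norm q ^ s"
      by (intro mult_left_mono) auto
    with t_bound[of c s] show ?thesis by linarith
  qed
  have t_sum: "(t c has_sum F c) UNIV" for c
    using has_sum_nat_geometric_bound[OF norm_ge_zero q, of "t c"] t_bound' unfolding F_def by blast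
  have t_sums: "t c sums F c" for c
    by (rule has_sum_imp_sums[OF t_sum])
  have t_diff: "t c 0 - t (Suc c) 0 = - (q ^ Suc c * t (Suc c) 0)" for c
  proof -
    have "t c 0 = 1 / w c" "t (Suc c) 0 = 1 / w (Suc c)"
      by (simp_all add: t_def w_def)
    moreover have "1 / w c - 1 / w (Suc c) = - (q ^ Suc c * (1 / w (Suc c)))"
      using w_nz[of c] w_nz[of "Suc c"] unfolding w_Suc by (simp add: divide_simps del: power_Suc)
    ultimately show ?thesis by metis
  qed
  have t_diff_Suc: "t c (Suc s) - t (Suc c) (Suc s)
      = q ^ Suc c * t (Suc (Suc c)) s - q ^ Suc c * t (Suc c) (Suc s)" for c s
  proof -
    have nz: "1 - q ^ Suc k \<noteq> 0" for k using power_neq_1[OF q, of "Suc k"] by simp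
    \<comment> \<open>In these symbols the claim is an identity of rational functions in
      \<open>q\<close>, \<open>X\<close> and \<open>Y\<close>; \<open>Q\<close>, \<open>w s\<close>
      and \<open>w (s + c)\<close> enter only through a common factor.\<close>
    define X where "X = q ^ s"
    define Y where "Y = q ^ c"
    define Q where "Q = q ^ (s\<^sup>2 + c * s)"
    have e: "q ^ ((Suc s)\<^sup>2 + c * Suc s) = Q * X\<^sup>2 * Y * q"
      "q ^ ((Suc s)\<^sup>2 + Suc c * Suc s) = Q * X^3 * Y * q^2"
      "q ^ (s\<^sup>2 + Suc (Suc c) * s) = Q * X\<^sup>2" "q ^ Suc c = q * Y"
      unfolding Q_def X_def Y_def
      by (simp_all add: power_add power_mult power_mult_distrib power2_eq_square power3_eq_cube mult_ac)
    have ws: "w (Suc s) = w s * (1 - q * X)" "w (Suc s + c) = w (s + c) * (1 - q * X * Y)"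
      "w (Suc s + Suc c) = w (s + c) * (1 - q * X * Y) * (1 - q * q * X * Y)"
      "w (s + Suc (Suc c)) = w (s + c) * (1 - q * X * Y) * (1 - q * q * X * Y)"
      by (simp_all add: w_Suc X_def Y_def power_add mult_ac)
    have nz': "1 - q * X \<noteq> 0" "1 - q * X * Y \<noteq> 0" "1 - q * q * X * Y \<noteq> 0"
      using nz[of s] nz[of "s + c"] nz[of "Suc (s + c)"]
      by (auto simp: X_def Y_def power_add mult_ac)
    show ?thesis
      unfolding t_def e ws using nz' w_nz[of s] w_nz[of "s + c"]
      by (simp add: divide_simps) (simp add: algebra_simps power2_eq_square power3_eq_cube)
  qed
  \<comment> \<open>Sum \<open>t_diff_Suc\<close> over s and restore the terms at s = 0 by means of
    \<open>t_diff\<close>.\<close>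
  have rec: "F c - F (Suc c) = q ^ Suc c * (F (Suc (Suc c)) - F (Suc c))" for c
  proof -
    have "(\<lambda>s. t c (Suc s) - t (Suc c) (Suc s)) sums (F c - t c 0 - (F (Suc c) - t (Suc c) 0))"
      by (intro sums_diff) (use t_sums in \<open>auto simp: sums_Suc_iff\<close>)
    moreover have "(\<lambda>s. q ^ Suc c * t (Suc (Suc c)) s - q ^ Suc c * t (Suc c) (Suc s)) sums
        (q ^ Suc c * F (Suc (Suc c)) - q ^ Suc c * (F (Suc c) - t (Suc c) 0))"
      by (intro sums_diff sums_mult) (use t_sums in \<open>auto simp: sums_Suc_iff\<close>)
    ultimately have "F c - t c 0 - (F (Suc c) - t (Suc c) 0)
        = q ^ Suc c * F (Suc (Suc c)) - q ^ Suc c * (F (Suc c) - t (Suc c) 0)"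
      unfolding t_diff_Suc by (rule sums_unique2)
    then have "F c - F (Suc c) = (t c 0 - t (Suc c) 0)
        + (q ^ Suc c * F (Suc (Suc c)) - q ^ Suc c * (F (Suc c) - t (Suc c) 0))"
      by (simp add: diff_eq_eq)
    then show ?thesis
      unfolding t_diff by (simp only: right_diff_distrib) simp
  qed
  have F_lim: "F \<longlonglongrightarrow> 1 / qpoch_inf q q"
  proof -
    \<comment> \<open>\<open>b\<close> is the termwise limit: \<open>q ^ (c * k)\<close> kills all
      terms with k > 0. Tannery's theorem with majorant C^2 |q|^k exchanges limit and sum.\<close>
    define b where "b k = (if k = 0 then 1 / qpoch_inf q q else 0)" for k :: nat
    have "(\<lambda>c. t c k) \<longlonglongrightarrow> b k" for k
    proof (cases "k = 0")
      case True
      have "(\<lambda>c. 1 / w c) \<longlonglongrightarrow> 1 / qpoch_inf q q"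
        unfolding w_def by (intro tendsto_intros qpoch_tendsto qpoch_inf_nonzero q)
      with True show ?thesis by (simp add: b_def t_def w_def)
    next
      case False
      have "(\<lambda>c. t c k) \<longlonglongrightarrow> 0"
      proof (rule Lim_null_comparison)
        have "norm (t c k) \<le> C\<^sup>2 * norm q ^ c" for c
        proof -
          have "c \<le> k\<^sup>2 + c * k"
            using False by (simp add: trans_le_add2)
          then have "norm q ^ (k\<^sup>2 + c * k) \<le> norm q ^ c"
            using q by (intro power_decreasing) auto
          then have "C\<^sup>2 * norm q ^ (k\<^sup>2 + c * k) \<le> C\<^sup>2 * norm q ^ c"
            by (intro mult_left_mono) auto
          with t_bound[of c k] show ?thesis by linarith
        qed
        then show "eventually (\<lambda>c. norm (t c k) \<le> C\<^sup>2 * norm q ^ c) sequentially" by simp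
        show "(\<lambda>c. C\<^sup>2 * norm q ^ c) \<longlonglongrightarrow> 0"
          using q by (intro tendsto_mult_right_zero LIMSEQ_power_zero) auto
      qed
      with False show ?thesis by (simp add: b_def)
    qed
    moreover have "summable (\<lambda>k. C\<^sup>2 * norm q ^ k)"
      using q by (intro summable_mult summable_geometric) auto
    ultimately have "(\<lambda>c. suminf (\<lambda>k. t c k)) \<longlonglongrightarrow> suminf b"
      using tannerys_theorem[of "\<lambda>k c. t c k" b sequentially "\<lambda>k. C\<^sup>2 * norm q ^ k"] t_bound'
      by (simp add: case_prod_unfold)
    moreover have "suminf b = 1 / qpoch_inf q q"
      by (subst suminf_finite[of "{0}"]) (auto simp: b_def)
    ultimately show ?thesis unfolding F_def by simp
  qed
  have const: "F c = F (Suc c)" for c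
  proof -
    \<comment> \<open>By \<open>rec\<close>, \<open>g\<close> is nondecreasing; being nonnegative
      with limit 0, it vanishes.\<close>
    define g where "g c = norm (F c - F (Suc c))" for c
    have "g c \<le> g (Suc c)" for c
    proof -
      have "g c = norm q ^ Suc c * g (Suc c)"
        unfolding g_def rec[of c] by (simp add: norm_mult norm_power norm_minus_commute)
      also have "\<dots> \<le> 1 * g (Suc c)"
        using q by (intro mult_right_mono power_le_one) (auto simp: g_def)
      finally show ?thesis by simp
    qed
    then have mono: "incseq g" by (rule incseq_SucI)
    have "g \<longlonglongrightarrow> norm (1 / qpoch_inf q q - 1 / qpoch_inf q q)"
      unfolding g_def by (intro tendsto_intros F_lim LIMSEQ_Suc[OF F_lim])
    then have "g \<longlonglongrightarrow> 0" by simp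
    from incseq_le[OF mono this, of c] show ?thesis by (simp add: g_def)
  qed
  have "F n = F 0" for n
    by (induction n) (use const in auto)
  then have "F = (\<lambda>_. F 0)" by auto
  with F_lim have "F 0 = 1 / qpoch_inf q q"
    by (metis LIMSEQ_const_iff)
  with \<open>F = _\<close> have "F c = 1 / qpoch_inf q q" by metis
  then show ?thesis
    using t_sum[of c] unfolding t_def w_def by simp
qed

text \<open>Multiply the Euler series for z and 1/z and group the pairs (m, n) by k = m - n and s =
  min m n. Since m^2 + n^2 = k^2 + 2 (s^2 + |k| s), each inner sum is a Durfee rectangle sum in base
  p^2 with c = |k|.\<close>

lemma jacobi_triple_product:
  fixes p z :: complex
  assumes p: "norm p < 1" "p \<noteq> 0" and z: "z \<noteq> 0"
  shows "((\<lambda>k. p powi k\<^sup>2 * z powi k) has_sum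
            (qpoch_inf (p\<^sup>2) (p\<^sup>2) * qpoch_inf (- (z * p)) (p\<^sup>2) * qpoch_inf (- (p / z)) (p\<^sup>2))) UNIV"
proof -
  have p2: "norm (p\<^sup>2) < 1" using p by (simp add: norm_power power_less_one_iff)
  define w where "w = qpoch (p\<^sup>2) (p\<^sup>2)"
  define f where "f m = p ^ m\<^sup>2 * z ^ m / w m" for m
  define g where "g n = p ^ n\<^sup>2 * (1 / z) ^ n / w n" for n
  define P where "P = qpoch_inf (- (z * p)) (p\<^sup>2) * qpoch_inf (- (p / z)) (p\<^sup>2)"
  have nat_int: "a + nat (int b - int a) = b" if "a \<le> b" for a b
    using that by simp
  have "(f has_sum qpoch_inf (- (z * p)) (p\<^sup>2)) UNIV" "(g has_sum qpoch_inf (- (p / z)) (p\<^sup>2)) UNIV"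
    using euler_qpoch_has_sum[OF p(1), of z] euler_qpoch_has_sum[OF p(1), of "1 / z"]
    by (simp_all add: f_def[abs_def] g_def[abs_def] w_def)
  then have "((\<lambda>(m, n). f m * g n) has_sum P) (UNIV \<times> UNIV)"
    unfolding P_def by (rule has_sum_mult_pairs)
  also have "?this \<longleftrightarrow> ((\<lambda>(k, s). f (s + nat k) * g (s + nat (- k))) has_sum P) (UNIV \<times> UNIV)"
    by (rule has_sum_reindex_bij_witness[of _ "\<lambda>(k, s). (s + nat k, s + nat (- k))"
          "\<lambda>(m, n). (int m - int n, min m n)"]) (auto simp: min_def nat_int)
  finally have "((\<lambda>k. p powi k\<^sup>2 * z powi k * (1 / qpoch_inf (p\<^sup>2) (p\<^sup>2))) has_sum P) UNIV"
  proof (rule has_sum_SigmaD)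
    fix k :: int
    define c where "c = nat \<bar>k\<bar>"
    have "f (s + nat k) * g (s + nat (- k))
        = p powi k\<^sup>2 * z powi k * ((p\<^sup>2) ^ (s\<^sup>2 + c * s) / (w s * w (s + c)))" for s
    proof -
      have "p powi k\<^sup>2 = p ^ c\<^sup>2"
        by (simp add: c_def flip: power_int_of_nat)
      moreover have "f (s + nat k) * g (s + nat (- k))
        = p ^ (s\<^sup>2 + (s + c)\<^sup>2) * z powi k / (w s * w (s + c))"
        using z by (cases "k \<ge> 0")
          (auto simp: f_def g_def c_def power_add power_int_def field_simps)
      moreover have "p ^ (s\<^sup>2 + (s + c)\<^sup>2) = p ^ c\<^sup>2 * (p\<^sup>2) ^ (s\<^sup>2 + c * s)"
        by (simp add: algebra_simps power2_eq_square flip: power_add power_mult)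
      ultimately show ?thesis by simp
    qed
    then show "((\<lambda>s. case (k, s) of (k, s) \<Rightarrow> f (s + nat k) * g (s + nat (- k)))
        has_sum p powi k\<^sup>2 * z powi k * (1 / qpoch_inf (p\<^sup>2) (p\<^sup>2))) UNIV"
      using has_sum_cmult_right[OF durfee_rectangle_has_sum[OF p2]] by (simp add: w_def)
  qed
  from has_sum_cmult_right[OF this, of "qpoch_inf (p\<^sup>2) (p\<^sup>2)"] show ?thesis
    using qpoch_inf_nonzero[OF p2 p2] by (simp add: P_def mult_ac)
qed

text \<open>The triple product at p = q^a, z = q^b. The coefficient \<open>b\<close> may be
  negative; naming a + b and a - b as naturals \<open>c\<close> and \<open>d\<close> keeps the
  exponents in the products natural and forces |b| <= a.\<close>

lemma theta_has_sum:
  fixes q :: complex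
  assumes q: "norm q < 1" "q \<noteq> 0" and "a > 0"
    and b: "int c = int a + b" "int d = int a - b"
  shows "((\<lambda>k. q powi (int a * k\<^sup>2 + b * k)) has_sum
            (qpoch_inf (q ^ (2 * a)) (q ^ (2 * a)) * qpoch_inf (- (q ^ c)) (q ^ (2 * a))
              * qpoch_inf (- (q ^ d)) (q ^ (2 * a)))) UNIV"
proof -
  have qa: "norm (q ^ a) < 1" "q ^ a \<noteq> 0" "q powi b \<noteq> 0"
    using q \<open>a > 0\<close> by (simp_all add: norm_power power_less_one_iff power_int_eq_0_iff)
  have "q powi (int a * k\<^sup>2 + b * k) = (q ^ a) powi k\<^sup>2 * (q powi b) powi k" for k
  proof -
    have "q powi (int a * k\<^sup>2 + b * k) = q powi (int a * k\<^sup>2) * q powi (b * k)"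
      using q by (intro power_int_add) auto
    also have "\<dots> = (q powi int a) powi k\<^sup>2 * (q powi b) powi k"
      by (simp only: power_int_mult)
    finally show ?thesis by (simp only: power_int_of_nat)
  qed
  moreover have "q powi b * q ^ a = q ^ c"
  proof -
    have "q ^ c = q powi (b + int a)"
      using b by (simp only: add.commute flip: power_int_of_nat)
    also have "\<dots> = q powi b * q powi int a"
      using q by (intro power_int_add) auto
    finally show ?thesis by (simp only: power_int_of_nat)
  qed
  moreover have "q ^ a / q powi b = q ^ d"
  proof -
    have "q ^ d = q powi (int a - b)"
      using b by (simp only: flip: power_int_of_nat)
    also have "\<dots> = q powi int a / q powi b"
      using q by (intro power_int_diff) auto
    finally show ?thesis by (simp only: power_int_of_nat)
  qed
  moreover have "(q ^ a)\<^sup>2 = q ^ (2 * a)"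
    by (simp only: mult.commute flip: power_mult)
  ultimately show ?thesis
    using jacobi_triple_product[OF qa] by simp
qed

subsection \<open>Double sums over indices of opposite parity\<close>

text \<open>The base \<open>x\<close> of the power is independent of \<open>q\<close>, so that x = r
  with r^4 = q is covered as well. The index maps are arbitrary because the bound on the inverse
  symbols is uniform.\<close>

lemma summable_on_qpoch_pairs:
  fixes q x :: complex
  assumes q: "norm q < 1" and x: "norm x < 1" and e: "\<And>i j. i + j \<le> e i j"
  shows "(\<lambda>(i, j). x ^ e i j / (qpoch q q (f i) * qpoch q q (g j))) summable_on A"
proof -
  obtain C where C: "C > 0" "\<And>n. norm (inverse (qpoch q q n)) \<le> C"
    using inverse_qpoch_q_bounded[OF q] by metis
  show ?thesis
  proof (rule summable_on_pairs_geometric_bound[OF norm_ge_zero x])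
    fix i j
    have "norm (case (i, j) of (i, j) \<Rightarrow> x ^ e i j / (qpoch q q (f i) * qpoch q q (g j)))
        = norm (inverse (qpoch q q (f i))) * norm (inverse (qpoch q q (g j))) * norm x ^ e i j"
      by (simp add: norm_divide norm_mult norm_power norm_inverse field_simps)
    also have "\<dots> \<le> C * C * norm x ^ (i + j)"
      using C x e by (intro mult_mono power_decreasing) auto
    finally show "norm (case (i, j) of (i, j) \<Rightarrow> x ^ e i j / (qpoch q q (f i) * qpoch q q (g j)))
        \<le> C * C * norm x ^ (i + j)" .
  qed
qed

lemma le_add_square: "i + j \<le> (i + j)\<^sup>2 + k" for i j k :: nat
  by (simp add: power2_eq_square trans_le_add1)

text \<open>Folds along the reflection k -> -k - 1, which preserves k^2 + k and exchanges n^2 with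
  (n + 1)^2.\<close>

lemma has_sum_int_split_sign:
  fixes f :: "int \<Rightarrow> complex"
  assumes "(f has_sum S) UNIV"
  shows "((\<lambda>n::nat. f (int n) + f (- int n - 1)) has_sum S) UNIV"
proof -
  have "(f has_sum S) UNIV \<longleftrightarrow> ((\<lambda>(n, b). f (if b then int n else - int n - 1)) has_sum S) (UNIV \<times> UNIV)"
    by (rule has_sum_reindex_bij_witness[of _ "\<lambda>(n, b). if b then int n else - int n - 1"
          "\<lambda>k. if k \<ge> 0 then (nat k, True) else (nat (- k - 1), False)"])
       (auto split: if_splits)
  with assms have "((\<lambda>(n, b). f (if b then int n else - int n - 1)) has_sum S) (UNIV \<times> UNIV)"
    by blast
  then show ?thesis
    by (rule has_sum_SigmaD) (auto simp: UNIV_bool intro!: has_sum_finiteI)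
qed

lemma has_sum_int_split_parity:
  fixes f :: "int \<Rightarrow> complex"
  assumes "((\<lambda>k. f (2 * k)) has_sum S) UNIV" "((\<lambda>k. f (2 * k - 1)) has_sum T) UNIV"
  shows "(f has_sum (S + T)) UNIV"
proof -
  have "((\<lambda>k. f (2 * k)) has_sum S) UNIV \<longleftrightarrow> (f has_sum S) {k. even k}"
    by (rule has_sum_reindex_bij_witness[of _ "\<lambda>k. k div 2" "\<lambda>k. 2 * k"]) auto
  moreover have "((\<lambda>k. f (2 * k - 1)) has_sum T) UNIV \<longleftrightarrow> (f has_sum T) {k. odd k}"
    by (rule has_sum_reindex_bij_witness[of _ "\<lambda>k. (k + 1) div 2" "\<lambda>k. 2 * k - 1"])
       (auto elim!: oddE)
  ultimately have "(f has_sum (S + T)) ({k. even k} \<union> {k. odd k})"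
    using assms by (intro has_sum_Un_disjoint) auto
  moreover have "{k :: int. even k} \<union> {k. odd k} = UNIV" by auto
  ultimately show ?thesis by simp
qed

text \<open>Regroups the pairs \<open>(2i + 1, 2j)\<close> by their minimum \<open>s\<close> and their difference \<open>2k + 1\<close>;
  the parity of \<open>s\<close> tells which of the two entries is the smaller one.\<close>

lemma odd_even_regroup_has_sum:
  fixes h u :: "nat \<Rightarrow> complex"
  assumes summable: "(\<lambda>(i, j). h (i + j) / (u (2 * i + 1) * u (2 * j))) summable_on UNIV"
    and inner: "\<And>k. ((\<lambda>s. h (s + k) / (u s * u (s + (2 * k + 1)))) has_sum G k) UNIV"
    and outer: "(G has_sum S) UNIV"
  shows "((\<lambda>(i, j). h (i + j) / (u (2 * i + 1) * u (2 * j))) has_sum S) UNIV"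
proof -
  have e1: "h (b + a) / (u (b * 2) * u (Suc (b * 2 + (a - b) * 2)))
      = h (a + b) / (u (b * 2) * u (Suc (a * 2)))" if "b \<le> a" for a b
    using that by (simp add: add.commute diff_mult_distrib)
  have e2: "Suc (Suc (a * 2 + 2 * (b - Suc a))) = b * 2" if "\<not> b \<le> a" for a b
    using that by simp
  obtain S' where S': "((\<lambda>(i, j). h (i + j) / (u (2 * i + 1) * u (2 * j))) has_sum S') UNIV"
    using summable by (auto simp: summable_on_def)
  \<comment> \<open>For even s the smaller entry is 2j = s, for odd s it is 2i + 1 = s; in both
    cases i + j = s + k, so the argument of \<open>h\<close> does not depend on the parity.\<close>
  also have "?this \<longleftrightarrow> ((\<lambda>(k, s). h (s + k) / (u s * u (s + (2 * k + 1)))) has_sum S') (UNIV \<times> UNIV)"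
    by (rule has_sum_reindex_bij_witness[of _
          "\<lambda>(k, s). if even s then (s div 2 + k, s div 2) else (s div 2, s div 2 + k + 1)"
          "\<lambda>(i, j). if i \<ge> j then (i - j, 2 * j) else (j - i - 1, 2 * i + 1)"])
       (auto simp: mult_ac e1 e2 elim!: evenE oddE split: if_splits)
  finally have "(G has_sum S') UNIV"
    by (rule has_sum_SigmaD) (simp only: prod.case inner)
  with outer have "S = S'"
    by (rule has_sum_unique)
  with S' show ?thesis
    by simp
qed

text \<open>Euler's theorem on odd and distinct parts, in product form: (q;q) = (q;q^2) (q^2;q^2)
  and (q^2;q^2) = (q;q) (-q;q), then cancel.\<close>

lemma qpoch_inf_euler:
  assumes q: "norm q < 1"
  shows "qpoch_inf q (q\<^sup>2) * qpoch_inf (- q) q = 1"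
proof -
  have q2: "norm (q\<^sup>2) < 1" using q by (simp add: norm_power power_less_one_iff)
  have "qpoch_inf q q = qpoch_inf q (q\<^sup>2) * qpoch_inf (q\<^sup>2) (q\<^sup>2)"
    using qpoch_inf_split_base[OF q, of q] by (simp add: power2_eq_square)
  moreover have "qpoch_inf (q\<^sup>2) (q\<^sup>2) = qpoch_inf q q * qpoch_inf (- q) q"
    by (rule qpoch_inf_square[OF q])
  ultimately show ?thesis
    using qpoch_inf_nonzero[OF q2 q2] by simp
qed

lemma odd_even_square_has_sum:
  fixes q :: complex
  assumes q: "norm q < 1" "q \<noteq> 0"
  shows "((\<lambda>(i, j). q ^ (i + j)\<^sup>2 / (qpoch q q (2 * i + 1) * qpoch q q (2 * j))) has_sum
            ((qpoch_inf (- q) (q\<^sup>2))\<^sup>2 / qpoch_inf q (q\<^sup>2))) UNIV"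
proof (rule odd_even_regroup_has_sum)
  have q2: "norm (q\<^sup>2) < 1" using q by (simp add: norm_power power_less_one_iff)
  show "(\<lambda>(i, j). q ^ (i + j)\<^sup>2 / (qpoch q q (2 * i + 1) * qpoch q q (2 * j))) summable_on UNIV"
    using le_add_square[of _ _ 0] by (intro summable_on_qpoch_pairs q) simp
  show "((\<lambda>s. q ^ (s + k)\<^sup>2 / (qpoch q q s * qpoch q q (s + (2 * k + 1)))) has_sum
      q ^ k\<^sup>2 * (1 / qpoch_inf q q) + q ^ (k + 1)\<^sup>2 * (1 / qpoch_inf q q)) UNIV" for k
  proof -
    \<comment> \<open>Write 1 = (1 - x) + x with x = q^(s+2k+1). The first part lowers the larger
      index to s + 2k, the second raises the exponent; both become Durfee terms, with c = 2k and c =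
      2k + 1.\<close>
    have "q ^ (s + k)\<^sup>2 / (qpoch q q s * qpoch q q (s + (2 * k + 1)))
      = q ^ k\<^sup>2 * (q ^ (s\<^sup>2 + 2 * k * s) / (qpoch q q s * qpoch q q (s + 2 * k)))
      + q ^ (k + 1)\<^sup>2 * (q ^ (s\<^sup>2 + (2 * k + 1) * s) / (qpoch q q s * qpoch q q (s + (2 * k + 1))))" for s
    proof -
      have "(s + k)\<^sup>2 = k\<^sup>2 + (s\<^sup>2 + 2 * k * s)"
        "(k + 1)\<^sup>2 + (s\<^sup>2 + (2 * k + 1) * s) = (s + k)\<^sup>2 + Suc (s + 2 * k)"
        by (simp_all add: power2_eq_square algebra_simps)
      then have e: "q ^ k\<^sup>2 * q ^ (s\<^sup>2 + 2 * k * s) = q ^ (s + k)\<^sup>2"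
        "q ^ (k + 1)\<^sup>2 * q ^ (s\<^sup>2 + (2 * k + 1) * s) = q ^ (s + k)\<^sup>2 * q ^ Suc (s + 2 * k)"
        by (metis power_add)+
      have "qpoch q q (s + (2 * k + 1)) = qpoch q q (s + 2 * k) * (1 - q ^ Suc (s + 2 * k))"
        using qpoch_q_Suc[of q "s + 2 * k"] by simp
      moreover have "1 - q ^ Suc (s + 2 * k) \<noteq> 0"
        using power_neq_1[OF q(1), of "Suc (s + 2 * k)"] by simp
      ultimately show ?thesis
        using qpoch_q_nonzero[OF q(1), of s] qpoch_q_nonzero[OF q(1), of "s + 2 * k"]
        unfolding times_divide_eq_right e
        by (simp add: divide_simps del: power_Suc) (simp add: algebra_simps del: power_Suc)
    qed
    then show ?thesis
      by (simp only:) (intro has_sum_add has_sum_cmult_right durfee_rectangle_has_sum q)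
  qed
  \<comment> \<open>The inner sums add up to q^(k^2) + q^((k+1)^2) over (q;q): the theta series of
    q^(k^2) folded onto the naturals.\<close>
  have "((\<lambda>k. q powi (int 1 * k\<^sup>2 + 0 * k)) has_sum
      (qpoch_inf (q ^ (2 * 1)) (q ^ (2 * 1)) * qpoch_inf (- (q ^ 1)) (q ^ (2 * 1))
        * qpoch_inf (- (q ^ 1)) (q ^ (2 * 1)))) UNIV"
    using q by (rule theta_has_sum) auto
  from has_sum_divide_const[OF has_sum_int_split_sign[OF this], of "qpoch_inf q q"]
  have *: "((\<lambda>n. (q powi (int n)\<^sup>2 + q powi (- int n - 1)\<^sup>2) / qpoch_inf q q) has_sum
      (qpoch_inf (q\<^sup>2) (q\<^sup>2) * (qpoch_inf (- q) (q\<^sup>2))\<^sup>2 / qpoch_inf q q)) UNIV"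
    by (simp add: power2_eq_square mult.assoc)
  have "(q powi (int n)\<^sup>2 + q powi (- int n - 1)\<^sup>2) / qpoch_inf q q
      = q ^ n\<^sup>2 * (1 / qpoch_inf q q) + q ^ (n + 1)\<^sup>2 * (1 / qpoch_inf q q)" for n
  proof -
    have "(int n)\<^sup>2 = int (n\<^sup>2)" "(- int n - 1)\<^sup>2 = int ((n + 1)\<^sup>2)"
      by (simp_all add: power2_eq_square algebra_simps)
    then show ?thesis by (simp only: power_int_of_nat add_divide_distrib) simp
  qed
  moreover have "qpoch_inf (q\<^sup>2) (q\<^sup>2) * (qpoch_inf (- q) (q\<^sup>2))\<^sup>2 / qpoch_inf q q
      = (qpoch_inf (- q) (q\<^sup>2))\<^sup>2 / qpoch_inf q (q\<^sup>2)"
    using qpoch_inf_split_base[OF q(1), of q] qpoch_inf_nonzero[OF q2 q2] by (simp add: power2_eq_square)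
  ultimately show "((\<lambda>n. q ^ n\<^sup>2 * (1 / qpoch_inf q q) + q ^ (n + 1)\<^sup>2 * (1 / qpoch_inf q q)) has_sum
      (qpoch_inf (- q) (q\<^sup>2))\<^sup>2 / qpoch_inf q (q\<^sup>2)) UNIV"
    using * by (simp only:)
qed

lemma odd_even_pronic_has_sum:
  fixes q :: complex
  assumes q: "norm q < 1" "q \<noteq> 0"
  shows "((\<lambda>(i, j). q ^ ((i + j)\<^sup>2 + (i + j)) / (qpoch q q (2 * i + 1) * qpoch q q (2 * j))) has_sum
            (1 / (qpoch_inf q (q\<^sup>2) * (qpoch_inf (q\<^sup>2) (q ^ 4))\<^sup>2))) UNIV"
proof (rule odd_even_regroup_has_sum)
  have q2: "norm (q\<^sup>2) < 1" using q by (simp add: norm_power power_less_one_iff)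
  show "(\<lambda>(i, j). q ^ ((i + j)\<^sup>2 + (i + j)) / (qpoch q q (2 * i + 1) * qpoch q q (2 * j))) summable_on UNIV"
    by (intro summable_on_qpoch_pairs q le_add_square)
  show "((\<lambda>s. q ^ ((s + k)\<^sup>2 + (s + k)) / (qpoch q q s * qpoch q q (s + (2 * k + 1)))) has_sum
      q ^ (k\<^sup>2 + k) * (1 / qpoch_inf q q)) UNIV" for k
  proof -
    have "(s + k)\<^sup>2 + (s + k) = (k\<^sup>2 + k) + (s\<^sup>2 + (2 * k + 1) * s)" for s
      by (simp add: power2_eq_square algebra_simps)
    then have "q ^ ((s + k)\<^sup>2 + (s + k)) / (qpoch q q s * qpoch q q (s + (2 * k + 1)))
      = q ^ (k\<^sup>2 + k) * (q ^ (s\<^sup>2 + (2 * k + 1) * s) / (qpoch q q s * qpoch q q (s + (2 * k + 1))))" for s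
      by (simp only: power_add[of q "k\<^sup>2 + k"] times_divide_eq_right)
    then show ?thesis
      by (simp only:) (intro has_sum_cmult_right durfee_rectangle_has_sum q)
  qed
  \<comment> \<open>Here d = 0 produces the factor (-1;q^2) = 2 (-q^2;q^2). Each exponent k^2 + k is
    attained by two integers, hence the later division by twice (q;q).\<close>
  have "((\<lambda>k. q powi (int 1 * k\<^sup>2 + 1 * k)) has_sum
      (qpoch_inf (q ^ (2 * 1)) (q ^ (2 * 1)) * qpoch_inf (- (q ^ 2)) (q ^ (2 * 1))
        * qpoch_inf (- (q ^ 0)) (q ^ (2 * 1)))) UNIV"
    using q by (rule theta_has_sum) auto
  from has_sum_divide_const[OF has_sum_int_split_sign[OF this], of "2 * qpoch_inf q q"]
  have *: "((\<lambda>n. (q powi ((int n)\<^sup>2 + int n) + q powi ((- int n - 1)\<^sup>2 + (- int n - 1))) / (2 * qpoch_inf q q)) has_sum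
      (qpoch_inf (q\<^sup>2) (q\<^sup>2) * qpoch_inf (- (q\<^sup>2)) (q\<^sup>2) * qpoch_inf (- 1) (q\<^sup>2) / (2 * qpoch_inf q q))) UNIV"
    by simp
  have "(q powi ((int n)\<^sup>2 + int n) + q powi ((- int n - 1)\<^sup>2 + (- int n - 1))) / (2 * qpoch_inf q q)
      = q ^ (n\<^sup>2 + n) * (1 / qpoch_inf q q)" for n
  proof -
    have "(int n)\<^sup>2 + int n = int (n\<^sup>2 + n)" "(- int n - 1)\<^sup>2 + (- int n - 1) = int (n\<^sup>2 + n)"
      by (simp_all add: power2_eq_square algebra_simps)
    then show ?thesis by (simp only: power_int_of_nat) simp
  qed
  moreover have "qpoch_inf (q\<^sup>2) (q\<^sup>2) * qpoch_inf (- (q\<^sup>2)) (q\<^sup>2) * qpoch_inf (- 1) (q\<^sup>2) / (2 * qpoch_inf q q)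
      = 1 / (qpoch_inf q (q\<^sup>2) * (qpoch_inf (q\<^sup>2) (q ^ 4))\<^sup>2)"
  proof -
    define a where "a = qpoch_inf q (q\<^sup>2)"
    define b where "b = qpoch_inf (- (q\<^sup>2)) (q\<^sup>2)"
    define c where "c = qpoch_inf (q\<^sup>2) (q\<^sup>2)"
    define d where "d = qpoch_inf (q\<^sup>2) (q ^ 4)"
    have "qpoch_inf (- 1) (q\<^sup>2) = 2 * b"
      using qpoch_inf_Suc[OF q2, of "- 1"] by (simp add: b_def)
    moreover have "qpoch_inf q q = a * c"
      using qpoch_inf_split_base[OF q(1), of q] by (simp add: a_def c_def power2_eq_square)
    moreover have "d * b = 1"
      using qpoch_inf_euler[OF q2] by (simp add: b_def d_def)
    moreover have "c \<noteq> 0" "a \<noteq> 0"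
      using qpoch_inf_nonzero[OF q2 q2] qpoch_inf_nonzero[OF q2 q(1)] by (simp_all add: a_def c_def)
    moreover from \<open>d * b = 1\<close> have "d \<noteq> 0" "b = 1 / d" by (auto simp: divide_simps mult.commute)
    ultimately show ?thesis
      unfolding a_def[symmetric] c_def[symmetric] b_def[symmetric] d_def[symmetric]
      by (simp add: power2_eq_square)
  qed
  ultimately show "((\<lambda>n. q ^ (n\<^sup>2 + n) * (1 / qpoch_inf q q)) has_sum
      1 / (qpoch_inf q (q\<^sup>2) * (qpoch_inf (q\<^sup>2) (q ^ 4))\<^sup>2)) UNIV"
    using * by (simp only:)
qed

subsection \<open>Theta dissections and Rogers-Szego polynomials\<close>

text \<open>The triple product with a = 2 and b = 1; the residues 1 and 3 modulo 4 merge into the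
  odd exponents.\<close>

lemma triangular_theta_has_sum:
  fixes q :: complex
  assumes q: "norm q < 1" "q \<noteq> 0"
  shows "((\<lambda>k. q powi (2 * k\<^sup>2 + k)) has_sum (qpoch_inf (q ^ 4) (q ^ 4) * qpoch_inf (- q) (q\<^sup>2))) UNIV"
proof -
  have q2: "norm (q\<^sup>2) < 1" using q by (simp add: norm_power power_less_one_iff)
  have "((\<lambda>k. q powi (int 2 * k\<^sup>2 + 1 * k)) has_sum
      (qpoch_inf (q ^ (2 * 2)) (q ^ (2 * 2)) * qpoch_inf (- (q ^ 3)) (q ^ (2 * 2))
        * qpoch_inf (- (q ^ 1)) (q ^ (2 * 2)))) UNIV"
    using q by (rule theta_has_sum) auto
  moreover have "(q\<^sup>2)\<^sup>2 = q ^ 4" "- q * q\<^sup>2 = - (q ^ 3)"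
    by (simp_all add: power2_eq_square eval_nat_numeral)
  then have "qpoch_inf (- q) (q\<^sup>2) = qpoch_inf (- q) (q ^ 4) * qpoch_inf (- (q ^ 3)) (q ^ 4)"
    using qpoch_inf_split_base[OF q2, of "- q"] by (simp only:)
  ultimately show ?thesis by (simp add: mult_ac)
qed

text \<open>Split the theta series by the parity of k. Both products on the right contain only even
  powers of \<open>q\<close>, so q -> -q changes just the sign between them.\<close>

lemma triangular_theta_dissection:
  fixes q :: complex
  assumes q: "norm q < 1" "q \<noteq> 0"
  shows "qpoch_inf (q ^ 4) (q ^ 4) * qpoch_inf (- q) (q\<^sup>2)
      = qpoch_inf (q ^ 16) (q ^ 16) * qpoch_inf (- (q ^ 10)) (q ^ 16) * qpoch_inf (- (q ^ 6)) (q ^ 16)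
      + q * (qpoch_inf (q ^ 16) (q ^ 16) * qpoch_inf (- (q ^ 2)) (q ^ 16) * qpoch_inf (- (q ^ 14)) (q ^ 16))"
    (is "_ = ?A + q * ?B")
proof -
  have "((\<lambda>k. q powi (int 8 * k\<^sup>2 + 2 * k)) has_sum
      (qpoch_inf (q ^ (2 * 8)) (q ^ (2 * 8)) * qpoch_inf (- (q ^ 10)) (q ^ (2 * 8))
        * qpoch_inf (- (q ^ 6)) (q ^ (2 * 8)))) UNIV"
    using q by (rule theta_has_sum) auto
  then have even: "((\<lambda>k. q powi (2 * (2 * k)\<^sup>2 + 2 * k)) has_sum ?A) UNIV"
    by (simp add: power_mult_distrib)
  have "((\<lambda>k. q powi (int 8 * k\<^sup>2 + (- 6) * k)) has_sum
      (qpoch_inf (q ^ (2 * 8)) (q ^ (2 * 8)) * qpoch_inf (- (q ^ 2)) (q ^ (2 * 8))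
        * qpoch_inf (- (q ^ 14)) (q ^ (2 * 8)))) UNIV"
    using q by (rule theta_has_sum) auto
  then have "((\<lambda>k. q * q powi (8 * k\<^sup>2 + (- 6) * k)) has_sum q * ?B) UNIV"
    by (intro has_sum_cmult_right) simp
  moreover have "q * q powi (8 * k\<^sup>2 + (- 6) * k) = q powi (2 * (2 * k - 1)\<^sup>2 + (2 * k - 1))" for k
  proof -
    have "2 * (2 * k - 1)\<^sup>2 + (2 * k - 1) = 1 + (8 * k\<^sup>2 + (- 6) * k)"
      by (simp add: power2_eq_square algebra_simps)
    moreover have "q powi (1 + (8 * k\<^sup>2 + (- 6) * k)) = q * q powi (8 * k\<^sup>2 + (- 6) * k)"
      using q by (subst power_int_add) auto
    ultimately show ?thesis by metis
  qed
  ultimately have odd: "((\<lambda>k. q powi (2 * (2 * k - 1)\<^sup>2 + (2 * k - 1))) has_sum q * ?B) UNIV"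
    by (simp only:)
  show ?thesis
    by (rule has_sum_unique[OF triangular_theta_has_sum[OF q] has_sum_int_split_parity[OF even odd]])
qed

text \<open>The residues 2, 6, 10, 14 modulo 16 assemble to (-q^2;q^4). This converts the quotients
  obtained from the dissection into products divided by (-q^2,-q^14;q^16) or
  (-q^6,-q^10;q^16).\<close>

lemma qpoch_inf_mod_16_products:
  fixes q :: complex
  assumes q: "norm q < 1"
  shows "qpoch_inf (- q) (q\<^sup>2) * qpoch_inf (q ^ 16) (q ^ 16)
        * (qpoch_inf (- (q ^ 2)) (q ^ 16) * qpoch_inf (- (q ^ 14)) (q ^ 16)
          * (qpoch_inf (- (q ^ 6)) (q ^ 16) * qpoch_inf (- (q ^ 10)) (q ^ 16)))
      = (qpoch_inf (- q) q)\<^sup>2 * qpoch_inf (- (q ^ 8)) (q ^ 8)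
        * (qpoch_inf (q ^ 4) (q ^ 4) * qpoch_inf q (q\<^sup>2))"
proof -
  have qn: "norm (q ^ n) < 1" if "n > 0" for n
    using q that by (simp add: norm_power power_less_one_iff)
  have mult: "q ^ m * q ^ n = q ^ (m + n)" "(q ^ m) ^ n = q ^ (m * n)" for m n
    by (simp_all add: power_add power_mult)
  define x where "x k = qpoch_inf (- (q ^ k)) (q ^ 16)" for k
  have "qpoch_inf (- (q ^ 2)) (q ^ 4) = qpoch_inf (- (q ^ 2)) (q ^ 8) * qpoch_inf (- (q ^ 6)) (q ^ 8)"
    "qpoch_inf (- (q ^ 2)) (q ^ 8) = x 2 * x 10" "qpoch_inf (- (q ^ 6)) (q ^ 8) = x 6 * x 14"
    "qpoch_inf (- (q ^ 2)) (q ^ 2) = qpoch_inf (- (q ^ 2)) (q ^ 4) * qpoch_inf (- (q ^ 4)) (q ^ 4)"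
    using qpoch_inf_split_base[OF qn[of 4], of "- (q ^ 2)"] qpoch_inf_split_base[OF qn[of 8], of "- (q ^ 2)"]
      qpoch_inf_split_base[OF qn[of 8], of "- (q ^ 6)"] qpoch_inf_split_base[OF qn[of 2], of "- (q ^ 2)"]
    unfolding x_def by (simp_all only: mult_minus_left mult) simp_all
  moreover have "qpoch_inf (- q) q = qpoch_inf (- q) (q\<^sup>2) * qpoch_inf (- (q\<^sup>2)) (q\<^sup>2)"
    using qpoch_inf_split_base[OF q, of "- q"] by (simp add: power2_eq_square)
  ultimately have m: "qpoch_inf (- q) q
      = qpoch_inf (- q) (q\<^sup>2) * (x 2 * x 14 * (x 6 * x 10)) * qpoch_inf (- (q ^ 4)) (q ^ 4)"
    by simp
  have "qpoch_inf (q ^ 16) (q ^ 16) = qpoch_inf (q ^ 8) (q ^ 8) * qpoch_inf (- (q ^ 8)) (q ^ 8)"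
    "qpoch_inf (q ^ 8) (q ^ 8) = qpoch_inf (q ^ 4) (q ^ 4) * qpoch_inf (- (q ^ 4)) (q ^ 4)"
    using qpoch_inf_square[OF qn[of 8], of "q ^ 8"] qpoch_inf_square[OF qn[of 4], of "q ^ 4"]
    by (simp_all only: mult) simp_all
  then have "qpoch_inf (- q) (q\<^sup>2) * qpoch_inf (q ^ 16) (q ^ 16) * (x 2 * x 14 * (x 6 * x 10))
      = qpoch_inf (- q) (q\<^sup>2) * (x 2 * x 14 * (x 6 * x 10)) * qpoch_inf (- (q ^ 4)) (q ^ 4)
        * qpoch_inf (- (q ^ 8)) (q ^ 8) * qpoch_inf (q ^ 4) (q ^ 4)"
    by (simp only: mult_ac)
  \<comment> \<open>Insert 1 = (q;q^2) (-q;q) to create the second factor (-q;q).\<close>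
  also have "\<dots> = qpoch_inf (- q) q * qpoch_inf (- (q ^ 8)) (q ^ 8) * qpoch_inf (q ^ 4) (q ^ 4)
        * (qpoch_inf q (q\<^sup>2) * qpoch_inf (- q) q)"
    unfolding qpoch_inf_euler[OF q] by (simp only: m mult_1_right)
  also have "\<dots> = (qpoch_inf (- q) q)\<^sup>2 * qpoch_inf (- (q ^ 8)) (q ^ 8)
        * (qpoch_inf (q ^ 4) (q ^ 4) * qpoch_inf q (q\<^sup>2))"
    by (simp only: power2_eq_square mult_ac)
  finally show ?thesis
    by (simp only: x_def)
qed

text \<open>Coefficients of \<open>1 / ((t; q)\<^sub>\<infinity> (c t; q)\<^sub>\<infinity>)\<close> in \<open>t\<close>, i.e. normalised Rogers-Szego polynomials.\<close>

definition rogers_szego :: "complex \<Rightarrow> complex \<Rightarrow> nat \<Rightarrow> complex" where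
  "rogers_szego c q N = (\<Sum>n\<le>N. c ^ n / (qpoch q q (N - n) * qpoch q q n))"

text \<open>Apply 1 - xy = (1 - x) + (1 - y) - (1 - x)(1 - y) with x = q^(M-n), y = q^n to each
  summand: every factor 1 - x or 1 - y lowers the index of one denominator.\<close>

lemma rogers_szego_rec:
  assumes q: "norm q < 1"
  shows "(1 - q ^ Suc (Suc N)) * rogers_szego c q (Suc (Suc N))
    = (1 + c) * rogers_szego c q (Suc N) - c * rogers_szego c q N"
proof -
  define a where "a n = 1 / qpoch q q n" for n
  have a_Suc: "(1 - q ^ Suc n) * a (Suc n) = a n" for n
    using qpoch_q_nonzero[OF q, of "Suc n"] unfolding a_def qpoch_q_Suc by (simp del: power_Suc)
  define M where "M = Suc (Suc N)"
  have R: "rogers_szego c q K = (\<Sum>n\<le>K. c ^ n * a (K - n) * a n)" for K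
    by (simp add: rogers_szego_def a_def)
  have one: "(\<Sum>n\<le>M. c ^ n * ((1 - q ^ (M - n)) * a (M - n)) * a n) = rogers_szego c q (Suc N)"
  proof -
    \<comment> \<open>The term n = M drops out because 1 - q^0 = 0; in the next two sums the term n
      = 0 drops out likewise.\<close>
    have "(\<Sum>n\<le>M. c ^ n * ((1 - q ^ (M - n)) * a (M - n)) * a n)
        = (\<Sum>n\<le>Suc N. c ^ n * ((1 - q ^ (M - n)) * a (M - n)) * a n)"
      by (simp add: M_def)
    also have "\<dots> = (\<Sum>n\<le>Suc N. c ^ n * a (Suc N - n) * a n)"
    proof (intro sum.cong refl)
      fix n assume "n \<in> {..Suc N}"
      then have "M - n = Suc (Suc N - n)" by (auto simp: M_def)
      then show "c ^ n * ((1 - q ^ (M - n)) * a (M - n)) * a n = c ^ n * a (Suc N - n) * a n"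
        by (simp only: a_Suc)
    qed
    finally show ?thesis by (simp only: R)
  qed
  have two: "(\<Sum>n\<le>M. c ^ n * a (M - n) * ((1 - q ^ n) * a n)) = c * rogers_szego c q (Suc N)"
  proof -
    have "(\<Sum>n\<le>M. c ^ n * a (M - n) * ((1 - q ^ n) * a n))
        = (\<Sum>n\<le>Suc N. c ^ Suc n * a (M - Suc n) * ((1 - q ^ Suc n) * a (Suc n)))"
      unfolding M_def by (subst sum.atMost_Suc_shift) simp
    also have "\<dots> = (\<Sum>n\<le>Suc N. c * (c ^ n * a (Suc N - n) * a n))"
      by (simp only: a_Suc) (simp add: M_def mult_ac del: sum.atMost_Suc)
    finally show ?thesis by (simp only: R sum_distrib_left)
  qed
  have three: "(\<Sum>n\<le>M. c ^ n * ((1 - q ^ (M - n)) * a (M - n)) * ((1 - q ^ n) * a n)) = c * rogers_szego c q N"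
  proof -
    have "(\<Sum>n\<le>M. c ^ n * ((1 - q ^ (M - n)) * a (M - n)) * ((1 - q ^ n) * a n))
        = (\<Sum>n\<le>Suc N. c ^ n * ((1 - q ^ (M - n)) * a (M - n)) * ((1 - q ^ n) * a n))"
      by (simp add: M_def)
    also have "\<dots> = (\<Sum>n\<le>N. c ^ Suc n * ((1 - q ^ (M - Suc n)) * a (M - Suc n)) * ((1 - q ^ Suc n) * a (Suc n)))"
      by (subst sum.atMost_Suc_shift) simp
    also have "\<dots> = (\<Sum>n\<le>N. c * (c ^ n * a (N - n) * a n))"
    proof (intro sum.cong refl)
      fix n assume "n \<in> {..N}"
      then have "M - Suc n = Suc (N - n)" by (auto simp: M_def)
      then show "c ^ Suc n * ((1 - q ^ (M - Suc n)) * a (M - Suc n)) * ((1 - q ^ Suc n) * a (Suc n))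
          = c * (c ^ n * a (N - n) * a n)"
        by (simp only: a_Suc) simp
    qed
    finally show ?thesis by (simp only: R sum_distrib_left)
  qed
  have "(1 - q ^ M) * rogers_szego c q M
      = (\<Sum>n\<le>M. c ^ n * ((1 - q ^ (M - n)) * a (M - n)) * a n)
      + (\<Sum>n\<le>M. c ^ n * a (M - n) * ((1 - q ^ n) * a n))
      - (\<Sum>n\<le>M. c ^ n * ((1 - q ^ (M - n)) * a (M - n)) * ((1 - q ^ n) * a n))"
    unfolding R sum_distrib_left sum.distrib[symmetric] sum_subtractf[symmetric]
  proof (intro sum.cong refl)
    fix n assume "n \<in> {..M}"
    then have "q ^ M = q ^ (M - n) * q ^ n" by (simp flip: power_add)
    then show "(1 - q ^ M) * (c ^ n * a (M - n) * a n)
        = c ^ n * ((1 - q ^ (M - n)) * a (M - n)) * a n + c ^ n * a (M - n) * ((1 - q ^ n) * a n)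
        - c ^ n * ((1 - q ^ (M - n)) * a (M - n)) * ((1 - q ^ n) * a n)"
      by (simp add: algebra_simps)
  qed
  then show ?thesis
    unfolding one two three by (simp add: M_def algebra_simps)
qed

lemma rogers_szego_0: "rogers_szego c q 0 = 1"
  by (simp add: rogers_szego_def)

lemma rogers_szego_1: "rogers_szego c q 1 = (1 + c) / (1 - q)"
  by (simp add: rogers_szego_def qpoch_def add_divide_distrib)

text \<open>At c = -1 the middle coefficient 1 + c vanishes and the recurrence steps by two.\<close>

lemma rogers_szego_minus_one:
  assumes q: "norm q < 1"
  shows "rogers_szego (- 1) q (2 * M) = 1 / qpoch (q\<^sup>2) (q\<^sup>2) M"
proof (induction M)
  case (Suc M)
  have e: "(q\<^sup>2) ^ Suc M = q ^ Suc (Suc (2 * M))" "2 * Suc M = Suc (Suc (2 * M))"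
    by (simp_all add: power2_eq_square power_mult)
  then have "(1 - (q\<^sup>2) ^ Suc M) * rogers_szego (- 1) q (2 * Suc M) = rogers_szego (- 1) q (2 * M)"
    using rogers_szego_rec[OF q, of "2 * M" "- 1"] by (simp del: power_Suc mult_Suc_right)
  moreover have "(q\<^sup>2) ^ Suc M \<noteq> 1"
    unfolding e by (rule power_neq_1[OF q]) simp
  ultimately have "rogers_szego (- 1) q (2 * Suc M) = rogers_szego (- 1) q (2 * M) / (1 - (q\<^sup>2) ^ Suc M)"
    by (simp add: eq_divide_eq mult.commute del: power_Suc mult_Suc_right)
  then show ?case
    unfolding Suc.IH qpoch_q_Suc by simp
qed (simp add: rogers_szego_0)

text \<open>Corresponds to (t;p^2) (pt;p^2) = (t;p) for the generating functions; proved here from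
  the recurrence.\<close>

lemma rogers_szego_sqrt:
  assumes p: "norm p < 1"
  shows "rogers_szego p (p\<^sup>2) N = 1 / qpoch p p N"
proof (induction N rule: induct_nat_012)
  case 1
  have "1 - p \<noteq> 0" "1 + p \<noteq> 0" "1 - p\<^sup>2 = (1 - p) * (1 + p)"
    using p by (auto simp: add_eq_0_iff algebra_simps power2_eq_square)
  then show ?case
    using rogers_szego_1[of p "p\<^sup>2"] by (simp add: qpoch_def)
next
  case (ge2 N)
  have p2: "norm (p\<^sup>2) < 1" using p by (simp add: norm_power power_less_one_iff)
  define x where "x = p ^ Suc N"
  have nz: "1 - x \<noteq> 0" "1 - (p * x)\<^sup>2 \<noteq> 0"
    using power_neq_1[OF p, of "Suc N"] power_neq_1[OF p2, of "Suc (Suc N)"]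
    by (simp_all add: x_def power_mult_distrib mult_ac flip: power_mult)
  then have nz': "1 - p * x \<noteq> 0" "1 + p * x \<noteq> 0"
    by (auto simp: power2_eq_square add_eq_0_iff)
  define w where "w = qpoch p p N"
  have w: "w \<noteq> 0" using qpoch_q_nonzero[OF p] by (simp add: w_def)
  have "(1 - (p * x)\<^sup>2) * rogers_szego p (p\<^sup>2) (Suc (Suc N))
      = (1 + p) * (1 / (w * (1 - x))) - p * (1 / w)"
    using rogers_szego_rec[OF p2, of N p] ge2
    by (simp add: x_def w_def qpoch_q_Suc power_mult_distrib mult_ac flip: power_mult)
  \<comment> \<open>The numerator (1 + p) - p (1 - x) is 1 + px, which cancels a factor of 1 -
    (px)^2.\<close>
  also have "\<dots> = (1 + p * x) / (w * (1 - x))"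
    using nz w by (simp add: divide_simps) (simp add: algebra_simps)
  also have "\<dots> = (1 - (p * x)\<^sup>2) * (1 / (w * (1 - x) * (1 - p * x)))"
    using nz nz' w by (simp add: divide_simps) (simp add: algebra_simps power2_eq_square)
  finally have "rogers_szego p (p\<^sup>2) (Suc (Suc N)) = 1 / (w * (1 - x) * (1 - p * x))"
    using nz(2) by (metis mult_left_cancel)
  then show ?case
    by (simp add: w_def x_def qpoch_q_Suc)
qed (simp add: rogers_szego_0)

subsection \<open>Double sums over indices of equal parity\<close>

lemma even_even_minus_odd_odd:
  fixes q :: complex
  assumes q: "norm q < 1"
    and even: "((\<lambda>(i, j). q ^ (i + j)\<^sup>2 / (qpoch q q (2 * i) * qpoch q q (2 * j))) has_sum E) UNIV"
    and odd: "((\<lambda>(i, j). q ^ ((i + j)\<^sup>2 + 2 * i + 2 * j) / (qpoch q q (2 * i + 1) * qpoch q q (2 * j + 1)))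
      has_sum D) UNIV"
  shows "E - q * D = qpoch_inf (- q) (q\<^sup>2)"
proof -
  \<comment> \<open>\<open>f\<close> is summed only where m + n is even, so the halving is exact. On
    odd-odd pairs the exponent is (i + j + 1)^2, which accounts for the factor q, and the sign is
    -1.\<close>
  define f where "f = (\<lambda>(m, n). (- 1) ^ n * q ^ ((m + n) div 2)\<^sup>2 / (qpoch q q m * qpoch q q n))"
  have "(f has_sum E) {(m, n). even m \<and> even n}"
    using even
    by (subst (asm) has_sum_reindex_bij_witness[where S = UNIV and T = "{(m, n). even m \<and> even n}"
          and j = "\<lambda>(i, j). (2 * i, 2 * j)" and i = "\<lambda>(m, n). (m div 2, n div 2)" and h = f and s' = E])
       (auto simp: f_def)
  moreover have "(f has_sum - q * D) {(m, n). odd m \<and> odd n}"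
  proof -
    have "- q * (q ^ ((i + j)\<^sup>2 + 2 * i + 2 * j) / (qpoch q q (2 * i + 1) * qpoch q q (2 * j + 1)))
        = f (2 * i + 1, 2 * j + 1)" for i j
    proof -
      have "((2 * i + 1 + (2 * j + 1)) div 2)\<^sup>2 = Suc ((i + j)\<^sup>2 + 2 * i + 2 * j)"
        by (simp add: power2_eq_square algebra_simps)
      then show ?thesis by (simp only: f_def prod.case power_Suc) simp
    qed
    then show ?thesis
      using has_sum_cmult_right[OF odd, of "- q"]
      by (subst (asm) has_sum_reindex_bij_witness[where S = UNIV and T = "{(m, n). odd m \<and> odd n}"
            and j = "\<lambda>(i, j). (2 * i + 1, 2 * j + 1)" and i = "\<lambda>(m, n). (m div 2, n div 2)"
            and h = f and s' = "- q * D"])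
         auto
  qed
  ultimately have "(f has_sum (E + - q * D)) ({(m, n). even m \<and> even n} \<union> {(m, n). odd m \<and> odd n})"
    by (rule has_sum_Un_disjoint) auto
  also have "{(m, n). even m \<and> even n} \<union> {(m, n). odd m \<and> odd n} = {(m, n). even (m + n :: nat)}"
    by auto
  finally have "(f has_sum (E - q * D)) {(m, n). even (m + n)}"
    by simp
  also have "?this \<longleftrightarrow> ((\<lambda>(M, n). f (2 * M - n, n)) has_sum (E - q * D)) (SIGMA M:UNIV. {..2 * M})"
    by (rule has_sum_reindex_bij_witness[of _ "\<lambda>(M, n). (2 * M - n, n)" "\<lambda>(m, n). ((m + n) div 2, n)"])
       auto
  finally have "((\<lambda>M. q ^ M\<^sup>2 * 1 ^ M / qpoch (q\<^sup>2) (q\<^sup>2) M) has_sum (E - q * D)) UNIV"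
  proof (rule has_sum_SigmaD)
    fix M :: nat
    have "q ^ M\<^sup>2 * 1 ^ M / qpoch (q\<^sup>2) (q\<^sup>2) M = q ^ M\<^sup>2 * rogers_szego (- 1) q (2 * M)"
      by (simp add: rogers_szego_minus_one[OF q])
    also have "\<dots> = (\<Sum>n\<le>2 * M. case (M, n) of (M, n) \<Rightarrow> f (2 * M - n, n))"
      unfolding rogers_szego_def sum_distrib_left by (intro sum.cong) (auto simp: f_def)
    finally show "((\<lambda>n. case (M, n) of (M, n) \<Rightarrow> f (2 * M - n, n)) has_sum
        q ^ M\<^sup>2 * 1 ^ M / qpoch (q\<^sup>2) (q\<^sup>2) M) {..2 * M}"
      by (intro has_sum_finiteI) auto
  qed
  from has_sum_unique[OF this euler_qpoch_has_sum[OF q, of 1]] show ?thesis by simp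
qed

text \<open>With T = h^2 / g the value of \<open>t8\<close>, the four unknown sums satisfy S1 = T -
  q S10, q S3 = T - S9, T = S9 + q S10 and S1 - q S3 = h, which determine them.\<close>

lemma parity_sums:
  fixes q :: complex
  assumes q: "norm q < 1" "q \<noteq> 0"
  defines "P \<equiv> (qpoch_inf (- q) q)\<^sup>2 * qpoch_inf (- (q ^ 8)) (q ^ 8)"
  defines "U \<equiv> P / (qpoch_inf (- (q ^ 2)) (q ^ 16) * qpoch_inf (- (q ^ 14)) (q ^ 16))"
  defines "V \<equiv> P / (qpoch_inf (- (q ^ 6)) (q ^ 16) * qpoch_inf (- (q ^ 10)) (q ^ 16))"
  shows even_even_square_has_sum:
      "((\<lambda>(i, j). q ^ (i + j)\<^sup>2 / (qpoch q q (2 * i) * qpoch q q (2 * j))) has_sum U) UNIV"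
    and odd_odd_square_has_sum: "((\<lambda>(i, j). q ^ ((i + j)\<^sup>2 + 2 * i + 2 * j) /
      (qpoch q q (2 * i + 1) * qpoch q q (2 * j + 1))) has_sum V) UNIV"
    and odd_even_square_2j_has_sum:
      "((\<lambda>(i, j). q ^ ((i + j)\<^sup>2 + 2 * j) / (qpoch q q (2 * i + 1) * qpoch q q (2 * j))) has_sum U) UNIV"
    and odd_even_square_2i_has_sum:
      "((\<lambda>(i, j). q ^ ((i + j)\<^sup>2 + 2 * i) / (qpoch q q (2 * i + 1) * qpoch q q (2 * j))) has_sum V) UNIV"
proof -
  define w where "w = qpoch q q"
  have w_nz: "w n \<noteq> 0" for n
    using qpoch_q_nonzero[OF q(1)] by (simp add: w_def)
  have w_Suc: "w (Suc n) = w n * (1 - q ^ Suc n)" for n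
    by (simp add: w_def qpoch_q_Suc)
  have w_div: "(1 - q ^ Suc n) / w (Suc n) = 1 / w n" for n
    using w_nz[of "Suc n"] unfolding w_Suc by (simp del: power_Suc)
  define t1 where "t1 = (\<lambda>(i, j). q ^ (i + j)\<^sup>2 / (w (2 * i) * w (2 * j)))"
  define t3 where "t3 = (\<lambda>(i, j). q ^ ((i + j)\<^sup>2 + 2 * i + 2 * j) / (w (2 * i + 1) * w (2 * j + 1)))"
  define t8 where "t8 = (\<lambda>(i, j). q ^ (i + j)\<^sup>2 / (w (2 * i + 1) * w (2 * j)))"
  define t9 where "t9 = (\<lambda>(i, j). q ^ ((i + j)\<^sup>2 + 2 * j) / (w (2 * i + 1) * w (2 * j)))"
  define t10 where "t10 = (\<lambda>(i, j). q ^ ((i + j)\<^sup>2 + 2 * i) / (w (2 * i + 1) * w (2 * j)))"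
  \<comment> \<open>\<open>t8\<close> weighted by q^(2i+1) q^(2j), the mixed term in the expansion
    of (1 - q^(2i+1)) (1 - q^(2j)).\<close>
  define z where "z = (\<lambda>(i, j). q ^ ((i + j)\<^sup>2 + (2 * (i + j) + 1)) / (w (2 * i + 1) * w (2 * j)))"
  have "t1 summable_on UNIV" "t3 summable_on UNIV" "t9 summable_on UNIV" "t10 summable_on UNIV"
      "z summable_on UNIV"
    unfolding t1_def t3_def t9_def t10_def z_def w_def
    using le_add_square[of _ _ 0]
    by (intro summable_on_qpoch_pairs q le_add_square; simp add: le_add_square add.assoc)+
  then obtain S1 S3 S9 S10 Z where
    S: "(t1 has_sum S1) UNIV" "(t3 has_sum S3) UNIV" "(t9 has_sum S9) UNIV" "(t10 has_sum S10) UNIV"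
       "(z has_sum Z) UNIV"
    unfolding summable_on_def by auto
  define h where "h = qpoch_inf (- q) (q\<^sup>2)"
  define g where "g = qpoch_inf q (q\<^sup>2)"
  have S8: "(t8 has_sum h\<^sup>2 / g) UNIV"
    using odd_even_square_has_sum[OF q] by (simp add: t8_def w_def h_def g_def)

  \<comment> \<open>The difference carries the factor 1 - q^(2i+1), which lowers the odd index to
    2i.\<close>
  have "((\<lambda>x. t8 x + - q * t10 x) has_sum (h\<^sup>2 / g + - q * S10)) UNIV"
    by (intro has_sum_add has_sum_cmult_right S S8)
  moreover have "t8 x + - q * t10 x = t1 x" for x
  proof (cases x)
    case (Pair i j)
    have "t8 x + - q * t10 x = q ^ (i + j)\<^sup>2 * ((1 - q ^ Suc (2 * i)) / w (Suc (2 * i))) / w (2 * j)"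
      by (simp add: Pair t8_def t10_def diff_divide_distrib right_diff_distrib left_diff_distrib
            power_add add_divide_distrib mult_ac)
    then show ?thesis
      unfolding w_div by (simp add: Pair t1_def)
  qed
  ultimately have "(t1 has_sum (h\<^sup>2 / g - q * S10)) UNIV" by simp
  then have r1: "S1 = h\<^sup>2 / g - q * S10"
    using S(1) by (metis has_sum_unique)

  have t89: "t8 (i, j) + - 1 * t9 (i, j) = q ^ (i + j)\<^sup>2 * ((1 - q ^ (2 * j)) / w (2 * j)) / w (2 * i + 1)" for i j
    by (simp add: t8_def t9_def diff_divide_distrib right_diff_distrib power_add mult_ac)
  have sq: "(i + Suc j)\<^sup>2 = Suc ((i + j)\<^sup>2 + 2 * i + 2 * j)" for i j :: nat
    by (simp add: power2_eq_square algebra_simps)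
  \<comment> \<open>Now 1 - q^(2j) lowers the even index; it annihilates j = 0, and the shift j -> j
    + 1 leaves odd-odd terms.\<close>
  have "((\<lambda>x. t8 x + - 1 * t9 x) has_sum (h\<^sup>2 / g + - 1 * S9)) UNIV"
    by (intro has_sum_add has_sum_cmult_right S S8)
  also have "?this \<longleftrightarrow> ((\<lambda>x. t8 x + - 1 * t9 x) has_sum (h\<^sup>2 / g + - 1 * S9)) {x. snd x > 0}"
    by (rule has_sum_cong_neutral) (auto simp: t8_def t9_def)
  also have "\<dots> \<longleftrightarrow> ((\<lambda>x. q * t3 x) has_sum (h\<^sup>2 / g + - 1 * S9)) UNIV"
  proof (rule has_sum_reindex_bij_witness[of _ "\<lambda>(i, j). (i, Suc j)" "\<lambda>(i, j). (i, j - 1)"])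
    fix x :: "nat \<times> nat" assume "x \<in> {x. snd x > 0}"
    then obtain i j where x: "x = (i, Suc j)" by (cases x; cases "snd x") auto
    have "t8 x + - 1 * t9 x = q ^ (i + Suc j)\<^sup>2 * (1 / w (2 * j + 1)) / w (2 * i + 1)"
      unfolding x t89 using w_div[of "2 * j + 1"] by simp
    then show "q * t3 (case x of (i, j) \<Rightarrow> (i, j - 1)) = t8 x + - 1 * t9 x"
      unfolding sq by (simp add: x t3_def mult_ac)
  qed auto
  finally have "((\<lambda>x. q * t3 x) has_sum (h\<^sup>2 / g - S9)) UNIV" by simp
  then have r2: "q * S3 = h\<^sup>2 / g - S9"
    using has_sum_cmult_right[OF S(2)] by (metis has_sum_unique)

  \<comment> \<open>Lowering both indices gives denominators with indices 2i and 2j - 1. Exchanging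
    the roles of the indices turns \<open>y\<close> into \<open>z\<close>, so both have sum
    \<open>Z\<close>, which cancels in the relation for \<open>t8\<close>.\<close>
  define y where "y = (\<lambda>(i, j). (1 - q ^ (2 * i + 1)) * (1 - q ^ (2 * j)) * t8 (i, j))"
  have y: "y (i, j) = q ^ (i + j)\<^sup>2 * (1 / w (2 * i)) * ((1 - q ^ (2 * j)) / w (2 * j))" for i j
    using w_div[of "2 * i", symmetric] by (simp add: y_def t8_def)
  have "(z has_sum Z) UNIV \<longleftrightarrow> (y has_sum Z) {x. snd x > 0}"
  proof (rule has_sum_reindex_bij_witness[of _ "\<lambda>(i, j). (j - 1, i)" "\<lambda>(i, j). (j, Suc i)"])
    fix x :: "nat \<times> nat"
    obtain i j where x: "x = (i, j)" by (cases x)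
    have "y (j, Suc i) = q ^ (j + Suc i)\<^sup>2 * (1 / w (2 * j)) * (1 / w (2 * i + 1))"
      unfolding y using w_div[of "2 * i + 1"] by simp
    also have "\<dots> = z (i, j)"
      unfolding sq by (simp add: z_def add_ac mult_ac)
    finally show "y (case x of (i, j) \<Rightarrow> (j, Suc i)) = z x"
      by (simp add: x)
  qed auto
  also have "\<dots> \<longleftrightarrow> (y has_sum Z) UNIV"
    by (rule has_sum_cong_neutral) (auto simp: y)
  finally have "(y has_sum Z) UNIV"
    using S(5) by blast
  then have "((\<lambda>x. t9 x + q * t10 x + y x + - 1 * z x) has_sum (S9 + q * S10 + Z + - 1 * Z)) UNIV"
    by (intro has_sum_add has_sum_cmult_right S)
  moreover have "t9 x + q * t10 x + y x + - 1 * z x = t8 x" for x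
  proof (cases x)
    case (Pair i j)
    define d where "d = q ^ (i + j)\<^sup>2 / (w (2 * i + 1) * w (2 * j))"
    have eqs: "t9 x = q ^ (2 * j) * d" "q * t10 x = q ^ (2 * i + 1) * d" "z x = q ^ (2 * i + 1) * q ^ (2 * j) * d"
      "y x = (1 - q ^ (2 * i + 1)) * (1 - q ^ (2 * j)) * d" "t8 x = d"
      by (simp_all add: Pair t8_def t9_def t10_def y_def z_def d_def power_add distrib_left mult_ac)
    show ?thesis unfolding eqs by (simp add: algebra_simps)
  qed
  ultimately have "(t8 has_sum (S9 + q * S10)) UNIV" by simp
  then have r3: "h\<^sup>2 / g = S9 + q * S10"
    using S8 by (metis has_sum_unique)

  have r4: "S1 - q * S3 = h"
    unfolding h_def by (rule even_even_minus_odd_odd[OF q(1)])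
      (use S in \<open>simp_all add: t1_def t3_def w_def\<close>)
  define c where "c = qpoch_inf (q ^ 4) (q ^ 4)"
  define A where "A = qpoch_inf (q ^ 16) (q ^ 16) * qpoch_inf (- (q ^ 10)) (q ^ 16) * qpoch_inf (- (q ^ 6)) (q ^ 16)"
  define B where "B = qpoch_inf (q ^ 16) (q ^ 16) * qpoch_inf (- (q ^ 2)) (q ^ 16) * qpoch_inf (- (q ^ 14)) (q ^ 16)"
  have qn: "norm (q ^ n) < 1" if "n > 0" for n
    using q that by (simp add: norm_power power_less_one_iff)
  have nz: "c \<noteq> 0" "g \<noteq> 0"
    using qpoch_inf_nonzero[OF qn[of 4] qn[of 4]] qpoch_inf_nonzero[OF qn[of 2] q(1)]
    by (simp_all add: c_def g_def)
  have x_nz: "qpoch_inf (- (q ^ k)) (q ^ 16) \<noteq> 0" if "k > 0" for k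
    using qn[OF that] by (intro qpoch_inf_nonzero qn) auto
  have ch: "c * h = A + q * B"
    using triangular_theta_dissection[OF q] by (simp add: c_def h_def A_def B_def)
  \<comment> \<open>The dissection at -q: \<open>c\<close>, \<open>A\<close> and \<open>B\<close>
    are even in \<open>q\<close>, while \<open>h\<close> becomes \<open>g\<close>.\<close>
  have cg: "c * g = A - q * B"
    using triangular_theta_dissection[of "- q"] q by (simp add: c_def g_def A_def B_def)
  have U: "U = h * A / (c * g)"
    using qpoch_inf_mod_16_products[OF q(1)] x_nz[of 2] x_nz[of 14] nz
    by (simp add: U_def P_def A_def h_def c_def g_def divide_simps mult_ac)
  have V: "V = h * B / (c * g)"
    using qpoch_inf_mod_16_products[OF q(1)] x_nz[of 6] x_nz[of 10] nz
    by (simp add: V_def P_def B_def h_def c_def g_def divide_simps mult_ac)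
  \<comment> \<open>Adding and subtracting the relations leaves c h + c g = 2 A and c h - c g = 2 q
    B in the numerators.\<close>
  have "2 * S1 = h\<^sup>2 / g + h" "2 * (q * S3) = h\<^sup>2 / g - h"
    using r1 r2 r3 r4 by (simp_all add: algebra_simps)
  moreover have "h\<^sup>2 / g + h = h * (c * h + c * g) / (c * g)" "h\<^sup>2 / g - h = h * (c * h - c * g) / (c * g)"
    using nz by (simp_all add: divide_simps) (simp_all add: algebra_simps power2_eq_square)
  ultimately have "2 * S1 = 2 * U" "2 * (q * S3) = 2 * (q * V)"
    unfolding ch cg U V by simp_all
  then have "S1 = U" "S3 = V" using q by simp_all
  moreover have "S9 = S1" "S10 = S3" using r1 r2 r3 q by (simp_all add: algebra_simps)
  ultimately show
    "((\<lambda>(i, j). q ^ (i + j)\<^sup>2 / (qpoch q q (2 * i) * qpoch q q (2 * j))) has_sum U) UNIV"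
    "((\<lambda>(i, j). q ^ ((i + j)\<^sup>2 + 2 * i + 2 * j) /
      (qpoch q q (2 * i + 1) * qpoch q q (2 * j + 1))) has_sum V) UNIV"
    "((\<lambda>(i, j). q ^ ((i + j)\<^sup>2 + 2 * j) / (qpoch q q (2 * i + 1) * qpoch q q (2 * j))) has_sum U) UNIV"
    "((\<lambda>(i, j). q ^ ((i + j)\<^sup>2 + 2 * i) / (qpoch q q (2 * i + 1) * qpoch q q (2 * j))) has_sum V) UNIV"
    using S by (simp_all add: t1_def t3_def t9_def t10_def w_def)
qed

subsection \<open>Dissection modulo 4\<close>

lemma even_odd_generating_function:
  fixes r :: complex
  assumes r: "norm r < 1"
  shows "((\<lambda>(m, n). r ^ ((m + n)\<^sup>2 + 2 * n) / (qpoch (r ^ 4) (r ^ 4) m * qpoch (r ^ 4) (r ^ 4) n))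
    has_sum qpoch_inf (- r) (r\<^sup>2)) UNIV"
proof -
  have r2: "norm (r\<^sup>2) < 1" and r4: "norm (r ^ 4) < 1" and e4: "(r\<^sup>2)\<^sup>2 = r ^ 4"
    using r by (simp_all add: norm_power power_less_one_iff flip: power_mult)
  define f where "f = (\<lambda>(m, n). r ^ ((m + n)\<^sup>2 + 2 * n) / (qpoch (r ^ 4) (r ^ 4) m * qpoch (r ^ 4) (r ^ 4) n))"
  have "f summable_on UNIV"
    unfolding f_def by (intro summable_on_qpoch_pairs r r4 le_add_square)
  then obtain S where S: "(f has_sum S) UNIV"
    by (auto simp: summable_on_def)
  also have "?this \<longleftrightarrow> ((\<lambda>(N, n). f (N - n, n)) has_sum S) (SIGMA N:UNIV. {..N})"
    by (rule has_sum_reindex_bij_witness[of _ "\<lambda>(N, n). (N - n, n)" "\<lambda>(m, n). (m + n, n)"]) auto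
  finally have "((\<lambda>N. r ^ N\<^sup>2 * 1 ^ N / qpoch (r\<^sup>2) (r\<^sup>2) N) has_sum S) UNIV"
  proof (rule has_sum_SigmaD)
    fix N :: nat
    have "r ^ N\<^sup>2 * 1 ^ N / qpoch (r\<^sup>2) (r\<^sup>2) N = r ^ N\<^sup>2 * rogers_szego (r\<^sup>2) (r ^ 4) N"
      using rogers_szego_sqrt[OF r2, of N] by (simp add: e4)
    also have "\<dots> = (\<Sum>n\<le>N. case (N, n) of (N, n) \<Rightarrow> f (N - n, n))"
      unfolding rogers_szego_def sum_distrib_left
      by (intro sum.cong) (auto simp: f_def power_add power_mult)
    finally show "((\<lambda>n. case (N, n) of (N, n) \<Rightarrow> f (N - n, n)) has_sum
        r ^ N\<^sup>2 * 1 ^ N / qpoch (r\<^sup>2) (r\<^sup>2) N) {..N}"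
      by (intro has_sum_finiteI) auto
  qed
  from has_sum_unique[OF this euler_qpoch_has_sum[OF r, of 1]] S show ?thesis
    by (simp add: f_def)
qed

text \<open>The powers of a fourth root of unity other than 1 sum to zero over a full
  period.\<close>

lemma power_int_imaginary_unit_filter:
  "(1 + \<i> powi n + (\<i> powi n)\<^sup>2 + (\<i> powi n) ^ 3) = (if n mod 4 = 0 then 4 else 0)"
proof -
  have "\<i> powi n = \<i> powi (4 * (n div 4) + n mod 4)"
    by simp
  also have "\<dots> = (\<i> powi 4) powi (n div 4) * \<i> powi (n mod 4)"
    by (subst power_int_add) (simp_all only: power_int_mult, simp)
  also have "\<i> powi 4 = 1"
    by (simp add: eval_nat_numeral)
  finally have n: "\<i> powi n = \<i> ^ nat (n mod 4)"
    by (simp add: power_int_def)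
  have "n mod 4 = 0 \<or> n mod 4 = 1 \<or> n mod 4 = 2 \<or> n mod 4 = 3"
    by presburger
  then show ?thesis
    unfolding n by (elim disjE) (simp_all add: eval_nat_numeral)
qed

text \<open>The value depends only on \<open>S\<close> and \<open>s\<close>, not on the index type.
  Two series with the same sums at all four points i^l r therefore agree on each residue class of
  exponents.\<close>

lemma has_sum_mod_4_filter:
  fixes c :: "'a \<Rightarrow> complex" and e :: "'a \<Rightarrow> int"
  assumes "r \<noteq> 0" and S: "\<And>l. ((\<lambda>a. c a * (\<i> ^ l * r) powi e a) has_sum S l) UNIV"
  shows "((\<lambda>a. c a * r powi e a) has_sum
    ((S 0 + \<i> powi (- s) * S 1 + (\<i> powi (- s))\<^sup>2 * S 2 + (\<i> powi (- s)) ^ 3 * S 3) / 4)) {a. (e a - s) mod 4 = 0}"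
    (is "(_ has_sum ?T) _")
proof -
  have "((\<lambda>a. (c a * (\<i> ^ 0 * r) powi e a + \<i> powi (- s) * (c a * (\<i> ^ 1 * r) powi e a)
      + (\<i> powi (- s))\<^sup>2 * (c a * (\<i> ^ 2 * r) powi e a) + (\<i> powi (- s)) ^ 3 * (c a * (\<i> ^ 3 * r) powi e a)) / 4) has_sum ?T) UNIV"
    by (intro has_sum_divide_const has_sum_add has_sum_cmult_right S)
  also have "?this \<longleftrightarrow> ((\<lambda>a. c a * r powi e a) has_sum ?T) {a. (e a - s) mod 4 = 0}"
  proof (rule has_sum_cong_neutral)
    have eq: "(c a * (\<i> ^ 0 * r) powi e a + \<i> powi (- s) * (c a * (\<i> ^ 1 * r) powi e a)
      + (\<i> powi (- s))\<^sup>2 * (c a * (\<i> ^ 2 * r) powi e a) + (\<i> powi (- s)) ^ 3 * (c a * (\<i> ^ 3 * r) powi e a)) / 4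
      = (if (e a - s) mod 4 = 0 then c a * r powi e a else 0)" for a
    proof -
      have pw: "(\<i> ^ l) powi e a = (\<i> powi e a) ^ l" for l
        by (simp add: power_int_power power_int_power' mult.commute)
      have "\<i> powi (e a - s) = \<i> powi e a * \<i> powi (- s)"
        using power_int_add[of "\<i>" "e a" "- s"] by simp
      then have *: "(c a * (\<i> ^ 0 * r) powi e a + \<i> powi (- s) * (c a * (\<i> ^ 1 * r) powi e a)
        + (\<i> powi (- s))\<^sup>2 * (c a * (\<i> ^ 2 * r) powi e a) + (\<i> powi (- s)) ^ 3 * (c a * (\<i> ^ 3 * r) powi e a)) / 4
        = c a * r powi e a * (1 + \<i> powi (e a - s) + (\<i> powi (e a - s))\<^sup>2 + (\<i> powi (e a - s)) ^ 3) / 4"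
        unfolding power_int_mult_distrib pw by (simp add: power_mult_distrib algebra_simps)
      show ?thesis
        unfolding * power_int_imaginary_unit_filter by simp
    qed
    show "(c a * (\<i> ^ 0 * r) powi e a + \<i> powi (- s) * (c a * (\<i> ^ 1 * r) powi e a)
      + (\<i> powi (- s))\<^sup>2 * (c a * (\<i> ^ 2 * r) powi e a) + (\<i> powi (- s)) ^ 3 * (c a * (\<i> ^ 3 * r) powi e a)) / 4 = 0"
      if "a \<in> UNIV - {a. (e a - s) mod 4 = 0}" for a
      unfolding eq using that by simp
    show "(c a * (\<i> ^ 0 * r) powi e a + \<i> powi (- s) * (c a * (\<i> ^ 1 * r) powi e a)
      + (\<i> powi (- s))\<^sup>2 * (c a * (\<i> ^ 2 * r) powi e a) + (\<i> powi (- s)) ^ 3 * (c a * (\<i> ^ 3 * r) powi e a)) / 4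
      = c a * r powi e a" if "a \<in> UNIV \<inter> {a. (e a - s) mod 4 = 0}" for a
      unfolding eq using that by simp
  qed auto
  finally show ?thesis .
qed

text \<open>The exponent is (x + y)^2 + 2y modulo 4 in the parities x, y; it takes the distinct
  residues 0, 1, 3, 2 at (0,0), (1,0), (0,1), (1,1).\<close>

lemma parities_from_mod_4:
  fixes a b m n :: nat
  assumes "a \<le> 1" "b \<le> 1" "((m + n)\<^sup>2 + 2 * n) mod 4 = ((a + b)\<^sup>2 + 2 * b) mod 4"
  shows "m mod 2 = a \<and> n mod 2 = b"
proof -
  define i j x y where "i = m div 2" and "j = n div 2" and "x = m mod 2" and "y = n mod 2"
  have mn: "m = 2 * i + x" "n = 2 * j + y"
    by (simp_all add: i_def j_def x_def y_def)
  have "(m + n)\<^sup>2 + 2 * n = 4 * ((i + j)\<^sup>2 + (x + y) * (i + j) + j) + ((x + y)\<^sup>2 + 2 * y)"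
    unfolding mn by (simp add: power2_eq_square algebra_simps)
  then have "((x + y)\<^sup>2 + 2 * y) mod 4 = ((a + b)\<^sup>2 + 2 * b) mod 4"
    using assms(3) by (metis mod_mult_self4)
  moreover have "x = 0 \<or> x = 1" "y = 0 \<or> y = 1" "a = 0 \<or> a = 1" "b = 0 \<or> b = 1"
    using assms by (auto simp: x_def y_def)
  ultimately have "x = a \<and> y = b"
    by (elim disjE) (simp_all add: power2_eq_square)
  then show ?thesis by (simp add: x_def y_def)
qed

text \<open>The difference factors as k - t times an odd number.\<close>

lemma triangular_mod_4:
  fixes k t :: int
  shows "(2 * k\<^sup>2 + k - (2 * t\<^sup>2 + t)) mod 4 = 0 \<longleftrightarrow> 4 dvd (k - t)"
proof -
  have "2 * k\<^sup>2 + k - (2 * t\<^sup>2 + t) = (k - t) * (2 * (k + t) + 1)"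
    by (simp add: power2_eq_square algebra_simps)
  moreover have "coprime (4 :: int) (2 * (k + t) + 1)"
  proof -
    have "coprime (2 ^ 2 :: int) (2 * (k + t) + 1)"
      by (subst coprime_power_left_iff) simp
    then show ?thesis by simp
  qed
  ultimately show ?thesis
    by (simp add: coprime_dvd_mult_left_iff flip: dvd_eq_mod_eq_0)
qed

text \<open>The integer \<open>t\<close> selects the theta index matching the parities (a, b): k =
  4k' + t turns 2k^2 + k into 4 (8k'^2 + (4t + 1) k') plus the residue \<open>v\<close>, whence
  \<open>c\<close> and \<open>d\<close>.\<close>

lemma parity_mod_4_component_has_sum:
  fixes q :: complex and t :: int
  assumes q: "norm q < 1" "q \<noteq> 0" and ab: "a \<le> 1" "b \<le> 1"
    and t: "int ((a + b)\<^sup>2 + 2 * b) = 2 * t\<^sup>2 + t"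
    and cd: "int c = 8 + (4 * t + 1)" "int d = 8 - (4 * t + 1)"
  shows "((\<lambda>(i, j). q ^ ((i + j)\<^sup>2 + (a + b) * (i + j) + j) / (qpoch q q (2 * i + a) * qpoch q q (2 * j + b)))
    has_sum (qpoch_inf (q ^ 16) (q ^ 16) * qpoch_inf (- (q ^ c)) (q ^ 16) * qpoch_inf (- (q ^ d)) (q ^ 16)
      / qpoch_inf q q)) UNIV"
proof -
  define r where "r = csqrt (csqrt q)"
  have r4: "r ^ 4 = q"
    unfolding r_def using power_mult[of "csqrt (csqrt q)" 2 2] by simp
  have r: "norm r < 1" "r \<noteq> 0"
  proof -
    have "norm r ^ 4 < 1" using q r4 by (metis norm_power)
    then show "norm r < 1" by (simp add: power_less_one_iff)
    show "r \<noteq> 0" using q r4 by auto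
  qed
  define v where "v = (a + b)\<^sup>2 + 2 * b"
  define u where "u = (\<lambda>(m, n). 1 / (qpoch q q m * qpoch q q n))"
  define e where "e = (\<lambda>(m, n). int ((m + n)\<^sup>2 + 2 * n))"
  define S where "S l = qpoch_inf (- (\<i> ^ l * r)) ((\<i> ^ l * r)\<^sup>2)" for l :: nat
  have xr: "norm (\<i> ^ l * r) < 1" "\<i> ^ l * r \<noteq> 0" "(\<i> ^ l * r) ^ 4 = q" for l :: nat
  proof -
    show "norm (\<i> ^ l * r) < 1" "\<i> ^ l * r \<noteq> 0"
      using r by (simp_all add: norm_mult norm_power)
    have "(\<i> ^ l) ^ 4 = (\<i> ^ 4) ^ l" by (simp only: mult.commute flip: power_mult)
    moreover have "\<i> ^ 4 = 1" by (simp add: eval_nat_numeral)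
    ultimately show "(\<i> ^ l * r) ^ 4 = q" by (simp add: power_mult_distrib r4)
  qed
  have left: "((\<lambda>x. u x * (\<i> ^ l * r) powi e x) has_sum S l) UNIV" for l
    using even_odd_generating_function[OF xr(1)[of l]] unfolding xr S_def u_def e_def
    by (simp add: case_prod_unfold power_int_of_nat del: of_nat_add of_nat_power of_nat_mult)
  \<comment> \<open>The fourth power of i^l r is \<open>q\<close>, so dividing the theta series by
    (q;q) leaves the same \<open>S l\<close> as the double series.\<close>
  have right: "((\<lambda>k. 1 / qpoch_inf q q * (\<i> ^ l * r) powi (2 * k\<^sup>2 + k)) has_sum S l) UNIV" for l
    using has_sum_cmult_right[OF triangular_theta_has_sum[OF xr(1,2)[of l]], of "1 / qpoch_inf q q"]
      qpoch_inf_nonzero[OF q(1) q(1)] unfolding xr S_def by simp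
  define T where "T = (S 0 + \<i> powi (- int v) * S 1 + (\<i> powi (- int v))\<^sup>2 * S 2 + (\<i> powi (- int v)) ^ 3 * S 3) / 4"
  \<comment> \<open>Restores integral powers of \<open>q\<close>; the common factor r^v is divided
    out at the end.\<close>
  have split: "r powi (4 * n + int v) = q powi n * r ^ v" for n
    using r by (simp add: power_int_add power_int_mult r4)

  have "((\<lambda>x. u x * r powi e x) has_sum T) {x. (e x - int v) mod 4 = 0}"
    unfolding T_def by (rule has_sum_mod_4_filter[OF r(2) left])
  also have "?this \<longleftrightarrow> ((\<lambda>(i, j). r ^ v * (q ^ ((i + j)\<^sup>2 + (a + b) * (i + j) + j) /
      (qpoch q q (2 * i + a) * qpoch q q (2 * j + b)))) has_sum T) UNIV"
  proof (rule has_sum_reindex_bij_witness[of _ "\<lambda>(i, j). (2 * i + a, 2 * j + b)" "\<lambda>(m, n). (m div 2, n div 2)"])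
    have e: "e (2 * i + a, 2 * j + b) = 4 * int ((i + j)\<^sup>2 + (a + b) * (i + j) + j) + int v" for i j
      by (simp add: e_def v_def power2_eq_square algebra_simps)
    fix x :: "nat \<times> nat" assume "x \<in> {x. (e x - int v) mod 4 = 0}"
    moreover obtain m n where mn: "x = (m, n)" by (cases x)
    ultimately have "int ((m + n)\<^sup>2 + 2 * n) mod 4 = int v mod 4"
      by (simp add: e_def mod_eq_dvd_iff dvd_eq_mod_eq_0)
    then have "int (((m + n)\<^sup>2 + 2 * n) mod 4) = int (v mod 4)"
      by (simp only: zmod_int of_nat_numeral)
    then have "((m + n)\<^sup>2 + 2 * n) mod 4 = v mod 4"
      by (simp only: of_nat_eq_iff)
    then have p: "m mod 2 = a" "n mod 2 = b"
      using parities_from_mod_4[OF ab] by (auto simp: v_def)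
    then have mn': "2 * (m div 2) + a = m" "2 * (n div 2) + b = n" by auto
    then show "(case (case x of (m, n) \<Rightarrow> (m div 2, n div 2)) of (i, j) \<Rightarrow> (2 * i + a, 2 * j + b)) = x"
      by (simp add: mn)
    have "u x * r powi e x = r ^ v * (q ^ ((m div 2 + n div 2)\<^sup>2 + (a + b) * (m div 2 + n div 2) + n div 2) /
      (qpoch q q m * qpoch q q n))"
      using e[of "m div 2" "n div 2"] unfolding mn' by (simp only: mn split power_int_of_nat) (simp add: u_def)
    then show "(case (case x of (m, n) \<Rightarrow> (m div 2, n div 2)) of (i, j) \<Rightarrow>
        r ^ v * (q ^ ((i + j)\<^sup>2 + (a + b) * (i + j) + j) / (qpoch q q (2 * i + a) * qpoch q q (2 * j + b))))
        = u x * r powi e x"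
      by (simp only: mn prod.case mn')
  next
    fix x :: "nat \<times> nat"
    obtain i j where x: "x = (i, j)" by (cases x)
    have "e (2 * i + a, 2 * j + b) = 4 * int ((i + j)\<^sup>2 + (a + b) * (i + j) + j) + int v"
      by (simp add: e_def v_def power2_eq_square algebra_simps)
    then show "(case x of (i, j) \<Rightarrow> (2 * i + a, 2 * j + b)) \<in> {x. (e x - int v) mod 4 = 0}"
      by (simp add: x)
    show "(case (case x of (i, j) \<Rightarrow> (2 * i + a, 2 * j + b)) of (m, n) \<Rightarrow> (m div 2, n div 2)) = x"
      using ab by (auto simp: x)
  qed auto
  finally have L: "((\<lambda>(i, j). r ^ v * (q ^ ((i + j)\<^sup>2 + (a + b) * (i + j) + j) /
      (qpoch q q (2 * i + a) * qpoch q q (2 * j + b)))) has_sum T) UNIV" .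

  have v: "int v = 2 * t\<^sup>2 + t" using t by (simp add: v_def)
  have "((\<lambda>k. 1 / qpoch_inf q q * r powi (2 * k\<^sup>2 + k)) has_sum T) {k. (2 * k\<^sup>2 + k - int v) mod 4 = 0}"
    unfolding T_def by (rule has_sum_mod_4_filter[OF r(2) right])
  also have "?this \<longleftrightarrow> ((\<lambda>k. r ^ v / qpoch_inf q q * q powi (int 8 * k\<^sup>2 + (4 * t + 1) * k)) has_sum T) UNIV"
  proof (rule has_sum_reindex_bij_witness[of _ "\<lambda>k. 4 * k + t" "\<lambda>k. (k - t) div 4"])
    fix k assume "k \<in> {k. (2 * k\<^sup>2 + k - int v) mod 4 = 0}"
    then have "4 dvd (k - t)" by (simp add: v triangular_mod_4)
    then obtain k' where k': "k = 4 * k' + t" by (auto simp: dvd_def algebra_simps)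
    then show "4 * ((k - t) div 4) + t = k" by simp
    have "2 * k\<^sup>2 + k = 4 * (int 8 * k'\<^sup>2 + (4 * t + 1) * k') + int v"
      unfolding v k' by (simp add: power2_eq_square algebra_simps)
    then show "r ^ v / qpoch_inf q q * q powi (int 8 * ((k - t) div 4)\<^sup>2 + (4 * t + 1) * ((k - t) div 4))
        = 1 / qpoch_inf q q * r powi (2 * k\<^sup>2 + k)"
      by (simp only: split) (simp add: k')
  next
    fix k :: int
    show "4 * k + t \<in> {k. (2 * k\<^sup>2 + k - int v) mod 4 = 0}"
      by (simp add: v triangular_mod_4)
  qed auto
  finally have R: "((\<lambda>k. r ^ v / qpoch_inf q q * q powi (int 8 * k\<^sup>2 + (4 * t + 1) * k)) has_sum T) UNIV" .
  have "((\<lambda>k. q powi (int 8 * k\<^sup>2 + (4 * t + 1) * k)) has_sum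
      (qpoch_inf (q ^ (2 * 8)) (q ^ (2 * 8)) * qpoch_inf (- (q ^ c)) (q ^ (2 * 8))
        * qpoch_inf (- (q ^ d)) (q ^ (2 * 8)))) UNIV"
    using q by (rule theta_has_sum) (use cd in auto)
  from has_sum_unique[OF R has_sum_cmult_right[OF this]]
  have T: "T = r ^ v * (qpoch_inf (q ^ 16) (q ^ 16) * qpoch_inf (- (q ^ c)) (q ^ 16)
      * qpoch_inf (- (q ^ d)) (q ^ 16) / qpoch_inf q q)"
    by simp
  from has_sum_cmult_right[OF L, of "1 / r ^ v"] show ?thesis
    unfolding T using r by (simp add: case_prod_unfold)
qed

section \<open>The case q = 0 and the assembly of the ten identities\<close>

lemma zero_base_has_sum:
  assumes e: "\<And>i j. e i j = 0 \<longleftrightarrow> i = 0 \<and> j = (0 :: nat)" and "c = 1"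
  shows "((\<lambda>(i :: nat, j). (0 :: complex) ^ e i j / (qpoch 0 0 (f i) * qpoch 0 0 (g j))) has_sum c) UNIV"
\<comment> \<open>By 0^0 = 1 only the pair (0, 0) contributes, and all symbols
  \<open>qpoch 0 0 n\<close> equal 1.\<close>
proof (rule has_sum_finite_neutralI)
  show "c = (\<Sum>(i, j)\<in>{(0, 0)}. 0 ^ e i j / (qpoch 0 0 (f i) * qpoch 0 0 (g j)))"
    using e[of 0 0] \<open>c = 1\<close> by (simp add: qpoch_def)
qed (use e in \<open>auto simp: power_0_left split: if_splits\<close>)

theorem theorem4p2:
  fixes q :: complex
  assumes "norm q < 1"
  shows "((\<lambda>(i, j). q ^ (i^2 + 2*i*j + j^2) / (qpoch q q (2*i) * qpoch q q (2*j))) has_sum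
            ((qpoch_inf (-q) q)^2 * qpoch_inf (-(q^8)) (q^8)
            / qpoch_inf_list [-(q^2), -(q^14)] (q^16))) UNIV \<and>
         ((\<lambda>(i, j). q ^ (i^2 + 2*i*j + j^2 + i + j) / (qpoch q q (2*i + 1) * qpoch q q (2*j))) has_sum
            (1 / (qpoch_inf q (q^2) * (qpoch_inf (q^2) (q^4))^2))) UNIV \<and>
         ((\<lambda>(i, j). q ^ (i^2 + 2*i*j + j^2 + 2*i + 2*j) / (qpoch q q (2*i + 1) * qpoch q q (2*j + 1))) has_sum
            ((qpoch_inf (-q) q)^2 * qpoch_inf (-(q^8)) (q^8)
            / qpoch_inf_list [-(q^6), -(q^10)] (q^16))) UNIV \<and>
         ((\<lambda>(i, j). q ^ (i^2 + 2*i*j + j^2 + j) / (qpoch q q (2*i) * qpoch q q (2*j))) has_sum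
            (qpoch_inf_list [-(q^7), -(q^9), q^16] (q^16) / qpoch_inf q q)) UNIV \<and>
         ((\<lambda>(i, j). q ^ (i^2 + 2*i*j + j^2 + i + 2*j) / (qpoch q q (2*i + 1) * qpoch q q (2*j))) has_sum
            (qpoch_inf_list [-(q^5), -(q^11), q^16] (q^16) / qpoch_inf q q)) UNIV \<and>
         ((\<lambda>(i, j). q ^ (i^2 + 2*i*j + j^2 + i + 2*j) / (qpoch q q (2*i) * qpoch q q (2*j + 1))) has_sum
            (qpoch_inf_list [-(q^3), -(q^13), q^16] (q^16) / qpoch_inf q q)) UNIV \<and>
         ((\<lambda>(i, j). q ^ (i^2 + 2*i*j + j^2 + 2*i + 3*j) / (qpoch q q (2*i + 1) * qpoch q q (2*j + 1))) has_sum
            (qpoch_inf_list [-q, -(q^15), q^16] (q^16) / qpoch_inf q q)) UNIV \<and>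
         ((\<lambda>(i, j). q ^ (i^2 + 2*i*j + j^2) / (qpoch q q (2*i + 1) * qpoch q q (2*j))) has_sum
            ((qpoch_inf (q^2) (q^4))^2 / (qpoch_inf q (q^2))^3)) UNIV \<and>
         ((\<lambda>(i, j). q ^ (i^2 + 2*i*j + j^2 + 2*j) / (qpoch q q (2*i + 1) * qpoch q q (2*j))) has_sum
            ((qpoch_inf (-q) q)^2 * qpoch_inf (-(q^8)) (q^8)
            / qpoch_inf_list [-(q^2), -(q^14)] (q^16))) UNIV \<and>
         ((\<lambda>(i, j). q ^ (i^2 + 2*i*j + j^2 + 2*i) / (qpoch q q (2*i + 1) * qpoch q q (2*j))) has_sum
            ((qpoch_inf (-q) q)^2 * qpoch_inf (-(q^8)) (q^8)
            / qpoch_inf_list [-(q^6), -(q^10)] (q^16))) UNIV"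
proof -
  have sq: "i\<^sup>2 + 2 * i * j + j\<^sup>2 = (i + j)\<^sup>2" for i j :: nat
    by (simp add: power2_eq_square algebra_simps)
  show ?thesis
  proof (cases "q = 0")
    case True
    have "qpoch_inf 0 x = 1" for x
      by (simp add: qpoch_inf_def)
    then show ?thesis
      unfolding True qpoch_inf_list_def by (intro conjI zero_base_has_sum) auto
  next
    case False
    note q = assms False
    note component = parity_mod_4_component_has_sum[OF q]
    have "norm (q\<^sup>2) < 1" "(q\<^sup>2)\<^sup>2 = q ^ 4"
      using assms by (simp_all add: norm_power power_less_one_iff flip: power_mult)
    \<comment> \<open>Uses (q^2;q^4) = (q;q^2) (-q;q^2) to rewrite the eighth right-hand
      side.\<close>
    then have "(qpoch_inf (q\<^sup>2) (q ^ 4))\<^sup>2 / (qpoch_inf q (q\<^sup>2)) ^ 3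
        = (qpoch_inf (- q) (q\<^sup>2))\<^sup>2 / qpoch_inf q (q\<^sup>2)"
      using qpoch_inf_square[of "q\<^sup>2" q] qpoch_inf_nonzero[of "q\<^sup>2" q] assms
      by (simp add: power_mult_distrib power2_eq_square power3_eq_cube)
    moreover have double: "n * 2 = n + n" and triple: "n * 3 = n + (n + n)" for n :: nat
      by simp_all
    \<comment> \<open>The values t = 0, -1, 1, -2 solve 2t^2 + t = 0, 1, 3, 6, the residues
      \<open>v\<close> of the four parity classes, and give the exponents 8 + (4t + 1) and 8 - (4t +
      1).\<close>
    ultimately show ?thesis
      unfolding sq
      using parity_sums[OF q] odd_even_square_has_sum[OF q] odd_even_pronic_has_sum[OF q]
        component[of 0 0 0 9 7] component[of 1 0 "- 1" 5 11]
        component[of 0 1 1 13 3] component[of 1 1 "- 2" 1 15]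
      by (simp add: qpoch_inf_list_def algebra_simps double triple)
  qed
qed

end
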